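(* Let $n\in\mathbb{P}$, $m:=\lfloor n/2\rfloor$, and let $I,J\subseteq[n-1]$ be unmixed, i.e. $I\cap J=(I+1)\cap J=I\cap(J+1)=\emptyset$. Let $I_1,\ldots,I_s$ be the connected components of $I$ and $J_1,\ldots,J_t$ those of $J$. Put $b_j:=\lfloor (|I_j|+1)/2\rfloor$, $d_k:=\lfloor (|J_k|+1)/2\rfloor$, $\tilde b:=\sum_j b_j$, $\tilde d:=\sum_k d_k$, $M:=\tilde b+\tilde d$, $\alpha(J):=\sum_{k=1}^t d_k^2$, and write $Q:=\left[\begin{matrix}M\\ b_1,\ldots,b_s,d_1,\ldots,d_t\end{matrix}\right]_{x^2}$. Then: (1) if $n$ is odd, $$\sum_{\sigma\in\mathcal{D}^I_J(C_{n,+})}(-1)^{\ell(\sigma)}x^{L(\sigma)}=(-x)^{\tilde d}x^{\alpha(J)}\,Q\prod_{k=M+1}^{m}(1-x^{2k});$$ (2) if $n$ is even, $$\sum_{\sigma\in\mathcal{D}^I_J(C_{n,+})}(-1)^{\ell(\sigma)}x^{L(\sigma)}=\begin{cases}(-x)^{\tilde d}x^{\alpha(J)}\dfrac{[\tilde b]_{x^2}}{[m]_{x^2}}\,Q,& \text{if } m=M,\\ (-x)^{\tilde d}x^{\alpha(J)}\,Q\displaystyle\prod_{k=M+1}^{m-1}(1-x^{2k}),&\text{otherwise,}\end{cases}$$ and $$\sum_{\sigma\in\mathcal{D}^I_J(C_{n,-})}(-1)^{\ell(\sigma)}x^{L(\sigma)}=\begin{cases}(-1)^{\tilde d}x^{\tilde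 b+\alpha(J)}\dfrac{[\tilde d]_{x^2}}{[m]_{x^2}}\,Q,& \text{if } m=M,\\ -(-x)^{\tilde d}x^{m+\alpha(J)}\,Q\displaystyle\prod_{k=M+1}^{m-1}(1-x^{2k}),&\text{otherwise.}\end{cases}$$
   Context: For integers $a\le b$, $[a,b]=\{a,\ldots,b\}$, $[n]=[1,n]$; $\mathbb{P}$ = positive integers; $A+1=\{a+1:a\in A\}$. Connected components of $K\subseteq[n-1]$ are the maximal intervals of consecutive integers contained in $K$. $S_n$ is the symmetric group on $[n]$; for $\sigma\in S_n$, $\ell(\sigma)$ is the number of pairs $i<j$ with $\sigma(i)>\sigma(j)$, $L(\sigma)$ is the number of such pairs with additionally $i\not\equiv j\pmod 2$, and $D(\sigma)=\{i\in[n-1]:\sigma(i)>\sigma(i+1)\}$. For disjoint $I,J\subseteq[n-1]$ and $X\subseteq S_n$, $\mathcal{D}^I_J(X):=\{\sigma\in X: J\subseteq D(\sigma)\subseteq[n-1]\setminus I\}$. $C_{n,+}=\{w\in S_n: i+w(i)\equiv 0\pmod 2\ \forall i\}$, $C_{n,-}=\{w\in S_n: i+w(i)\equiv 1\pmod 2\ \forall i\}$. $[k]_q=(1-q^k)/(1-q)$, $[k]_q!=\prod_{i=1}^k[i]_q$, and $\left[\begin{matrix}N\\ n_1,\ldots,n_r\end{matrix}\right]_q=\frac{[N]_q!}{[n_1]_q!\cdots[n_r]_q!}$ for $n_1+\cdots+n_r=N$. *)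

theory Defs
  imports
    "HOL-Combinatorics.Permutations"
    "HOL-Library.Multiset"
    "HOL-Computational_Algebra.Polynomial_Factorial"
begin

definition conn_components :: "nat set \<Rightarrow> nat set set" where
  "conn_components K =
     {C. (\<exists>a b. a \<le> b \<and> C = {a..b}) \<and> C \<subseteq> K \<and>
         (\<forall>a b. C \<subseteq> {a..b} \<and> {a..b} \<subseteq> K \<longrightarrow> {a..b} = C)}"

definition unmixed :: "nat set \<Rightarrow> nat set \<Rightarrow> bool" where
  "unmixed I J \<longleftrightarrow> I \<inter> J = {} \<and> (Suc ` I) \<inter> J = {} \<and> I \<inter> (Suc ` J) = {}"

(* Applied to I this is the multiset {b_1, ..., b_s}, applied to J it is {d_1, ..., d_t}. *)
definition half_parts :: "nat set \<Rightarrow> nat multiset" where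
  "half_parts K = image_mset (\<lambda>C. (card C + 1) div 2) (mset_set (conn_components K))"

definition sym_group :: "nat \<Rightarrow> (nat \<Rightarrow> nat) set" where
  "sym_group n = {\<sigma>. \<sigma> permutes {1..n}}"

definition inv_length :: "nat \<Rightarrow> (nat \<Rightarrow> nat) \<Rightarrow> nat" where
  "inv_length n \<sigma> = card {(i, j). i \<in> {1..n} \<and> j \<in> {1..n} \<and> i < j \<and> \<sigma> i > \<sigma> j}"

definition odd_length :: "nat \<Rightarrow> (nat \<Rightarrow> nat) \<Rightarrow> nat" where
  "odd_length n \<sigma> =
     card {(i, j). i \<in> {1..n} \<and> j \<in> {1..n} \<and> i < j \<and> \<sigma> i > \<sigma> j \<and> i mod 2 \<noteq> j mod 2}"

definition descents :: "nat \<Rightarrow> (nat \<Rightarrow> nat) \<Rightarrow> nat set" where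
  "descents n \<sigma> = {i \<in> {1..n - 1}. \<sigma> i > \<sigma> (i + 1)}"

definition desc_class ::
    "nat \<Rightarrow> nat set \<Rightarrow> nat set \<Rightarrow> (nat \<Rightarrow> nat) set \<Rightarrow> (nat \<Rightarrow> nat) set" where
  "desc_class n I J X = {\<sigma> \<in> X. J \<subseteq> descents n \<sigma> \<and> descents n \<sigma> \<subseteq> {1..n - 1} - I}"

definition chess_plus :: "nat \<Rightarrow> (nat \<Rightarrow> nat) set" where
  "chess_plus n = {w \<in> sym_group n. \<forall>i \<in> {1..n}. (i + w i) mod 2 = 0}"

definition chess_minus :: "nat \<Rightarrow> (nat \<Rightarrow> nat) set" where
  "chess_minus n = {w \<in> sym_group n. \<forall>i \<in> {1..n}. (i + w i) mod 2 = 1}"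

definition q_int :: "'a::field \<Rightarrow> nat \<Rightarrow> 'a" where
  "q_int q k = (1 - q ^ k) / (1 - q)"

definition q_fact :: "'a::field \<Rightarrow> nat \<Rightarrow> 'a" where
  "q_fact q k = (\<Prod>i = 1..k. q_int q i)"

(* Meant for N equal to the sum of the multiset ns of lower entries. *)
definition q_multinomial :: "'a::field \<Rightarrow> nat \<Rightarrow> nat multiset \<Rightarrow> 'a" where
  "q_multinomial q N ns = q_fact q N / (\<Prod>k \<in># ns. q_fact q k)"

(* The indeterminate x. Working in the fraction field of the integer polynomials makes every
   division by 1 - x^2 and by a q-factorial in x^2 a genuine one. *)
definition indet :: "int poly fract" where
  "indet = to_fract [:0, 1:]"

definition signed_odd_gf :: "nat \<Rightarrow> (nat \<Rightarrow> nat) set \<Rightarrow> int poly fract" where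
  "signed_odd_gf n X = (\<Sum>\<sigma> \<in> X. (- 1) ^ inv_length n \<sigma> * indet ^ odd_length n \<sigma>)"

(* Finiteness matters in half_parts: mset_set of an infinite set is empty. *)
lemma finite_conn_components: "finite K \<Longrightarrow> finite (conn_components K)"
  by (rule finite_subset[of _ "Pow K"]) (auto simp: conn_components_def)

end

theory Submission
  imports Defs
begin

text \<open>
  Let $e_1, e_2, \ldots$ be generators with $e_v^2 = 0$ and, for $u > v$, $e_u e_v = - e_v e_u$ if
  $u \equiv v$ mod 2 and $e_u e_v = - x e_v e_u$ otherwise. On chessboard elements $L$ can be read
  off the parities of the values, so
  $e_{\sigma(1)} \cdots e_{\sigma(n)} = (-1)^{\ell(\sigma)} x^{L(\sigma)} e_1 \cdots e_n$, and the
  sum over a descent class is the coefficient of $e_1 \cdots e_n$ in a product with one factor for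
  each maximal block of positions on which $\sigma$ is forced to be monotone. A factor for an
  increasing block of size $s$ is the sum $h_s$ of all increasing products of length $s$ whose
  parities alternate from a prescribed start; a decreasing block gives a monomial times such a sum.

  Let $O$ and $E$ be the sums of the odd and of the even generators. Then $O^2 = E^2 = 0$, and
  a cancellation of neighbouring terms evaluates $O h_s$ and $E h_s$. With
  $c_k = \prod_{i \le k} (1 - x^{2i})^{-1}$ this gives, for start parity odd,
  $h_{2k} = c_k ((OE)^k + x^k (EO)^k)$ and $h_{2k+1} = c_k O (EO)^k$. Since alternating words in
  $O$ and $E$ multiply to an alternating word or to 0, every product of blocks is a combination of
  at most two such words; only one of them survives as soon as some block has odd size. The top
  coefficients of the words themselves come from the same formulas, as $h_n$ for start parity odd
  has coefficient 1 at $e_1 \cdots e_n$, and $h_n$ for start parity even has coefficient 0.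
\<close>

section \<open>Alternating lists, descent patterns and connected components\<close>

fun alternating :: "bool \<Rightarrow> nat list \<Rightarrow> bool" where
  "alternating a [] = True"
| "alternating a (u # us) = (odd u = a \<and> alternating (\<not> a) us)"

lemma alternating_iff_nth:
  "alternating a us \<longleftrightarrow> (\<forall>i<length us. odd (us ! i) = (a \<noteq> odd i))"
  by (induction us arbitrary: a) (simp_all add: All_less_Suc2, blast)

lemma alternating_append:
  "alternating a (us @ vs) \<longleftrightarrow> alternating a us \<and> alternating (a \<noteq> odd (length us)) vs"
proof (induction us arbitrary: a)
  case (Cons u us)
  have "((\<not> a) \<noteq> odd (length us)) = (a \<noteq> odd (length (u # us)))" by auto
  then show ?case by (simp only: append_Cons alternating.simps Cons conj_assoc)
qed simp

text \<open>An alternating list of even length ends in the parity opposite to its start, one of odd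
  length in the same parity.\<close>

lemma alternating_rev:
  "alternating a (rev us) = alternating (if even (length us) then \<not> a else a) us"
  by (induction us arbitrary: a) (simp_all add: alternating_append, blast)

lemma alternating_upt: "alternating a [Suc k..<Suc k + n] \<longleftrightarrow> n = 0 \<or> a = even k"
proof -
  have "alternating (even k) [Suc k..<Suc k + n]"
    by (auto simp: alternating_iff_nth simp del: upt_Suc)
  then show ?thesis
    by (cases n) (auto simp: upt_conv_Cons simp del: upt_Suc)
qed

text \<open>List index \<open>i\<close> stands for position \<open>p + i\<close> of the permutation,
  so a final segment of a word keeps its absolute positions and \<open>I\<close> and
  \<open>J\<close> never have to be shifted.\<close>

definition descent_pattern ::
    "nat \<Rightarrow> nat \<Rightarrow> bool \<Rightarrow> nat set \<Rightarrow> nat set \<Rightarrow> nat list \<Rightarrow> bool" where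
  "descent_pattern p N a I J us \<longleftrightarrow> length us = N \<and> alternating a us \<and>
     (\<forall>i. Suc i < N \<longrightarrow>
        (p + i \<in> I \<longrightarrow> us ! i < us ! Suc i) \<and> (p + i \<in> J \<longrightarrow> us ! i > us ! Suc i))"

text \<open>Position \<open>p + s - 1\<close> governs the comparison between the first
  \<open>s\<close> entries and the rest. If it lies in neither set, the two segments are linked only
  through the alternation of parities.\<close>

lemma descent_pattern_split:
  assumes "0 < s" "s \<le> N" "p + s - 1 \<notin> I" "p + s - 1 \<notin> J"
  shows "descent_pattern p N a I J us \<longleftrightarrow>
    (\<exists>vs ws. us = vs @ ws \<and> descent_pattern p s a I J vs \<and>
       descent_pattern (p + s) (N - s) (a \<noteq> odd s) I J ws)"
proof
  assume L: "descent_pattern p N a I J us"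
  have "us = take s us @ drop s us" by simp
  moreover have "length (take s us) = s" using L assms by (simp add: descent_pattern_def)
  ultimately have "alternating a (take s us)" "alternating (a \<noteq> odd s) (drop s us)"
    using L unfolding descent_pattern_def by (metis alternating_append)+
  moreover have "p + (s + i) \<in> I \<longrightarrow> us ! (s + i) < us ! (s + Suc i)"
     "p + (s + i) \<in> J \<longrightarrow> us ! (s + i) > us ! (s + Suc i)" if "Suc i < N - s" for i
    using L that unfolding descent_pattern_def by (auto dest!: spec[of _ "s + i"])
  ultimately have "descent_pattern p s a I J (take s us)"
      "descent_pattern (p + s) (N - s) (a \<noteq> odd s) I J (drop s us)"
    using L assms by (auto simp: descent_pattern_def add.assoc)
  then show "\<exists>vs ws. us = vs @ ws \<and> descent_pattern p s a I J vs \<and>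
       descent_pattern (p + s) (N - s) (a \<noteq> odd s) I J ws"
    by (metis append_take_drop_id)
next
  assume "\<exists>vs ws. us = vs @ ws \<and> descent_pattern p s a I J vs \<and>
       descent_pattern (p + s) (N - s) (a \<noteq> odd s) I J ws"
  then obtain vs ws where us: "us = vs @ ws" and vs: "descent_pattern p s a I J vs"
    and ws: "descent_pattern (p + s) (N - s) (a \<noteq> odd s) I J ws" by blast
  have "(p + i \<in> I \<longrightarrow> us ! i < us ! Suc i) \<and> (p + i \<in> J \<longrightarrow> us ! i > us ! Suc i)"
    if i: "Suc i < N" for i
  proof -
    consider "Suc i < s" | "i = s - 1" | "s \<le> i" by linarith
    then show ?thesis
    proof cases
      case 1
      then show ?thesis using vs us by (auto simp: descent_pattern_def nth_append)
    next
      case 2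
      then show ?thesis using assms by simp
    next
      case 3
      then obtain j where "i = s + j" using le_Suc_ex by blast
      then show ?thesis using vs ws us i
        by (auto simp: descent_pattern_def nth_append add.assoc)
    qed
  qed
  then show "descent_pattern p N a I J us"
    using us vs ws assms by (auto simp: descent_pattern_def alternating_append)
qed

lemma descent_pattern_increasing:
  assumes "\<And>i. Suc i < s \<Longrightarrow> p + i \<in> I" "\<And>i. Suc i < s \<Longrightarrow> p + i \<notin> J"
  shows "descent_pattern p s a I J us \<longleftrightarrow> length us = s \<and> alternating a us \<and> sorted_wrt (<) us"
  using assms unfolding descent_pattern_def sorted_wrt_iff_nth_Suc_transp[OF transp_on_less] by blast

lemma descent_pattern_decreasing:
  assumes "\<And>i. Suc i < s \<Longrightarrow> p + i \<in> J" "\<And>i. Suc i < s \<Longrightarrow> p + i \<notin> I"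
  shows "descent_pattern p s a I J us \<longleftrightarrow> length us = s \<and> alternating a us \<and> sorted_wrt (>) us"
  using assms unfolding descent_pattern_def sorted_wrt_iff_nth_Suc_transp[OF transp_on_greater] by blast

section \<open>Connected components and their half sizes\<close>

text \<open>Maximality need only be tested against enlarging by one element at either end. The left
  neighbour appears as \<open>c\<close> with \<open>a = Suc c\<close> because \<open>a\<close> may
  be 0.\<close>

lemma interval_in_conn_components:
  assumes "a \<le> b"
  shows "{a..b} \<in> conn_components K \<longleftrightarrow>
    {a..b} \<subseteq> K \<and> Suc b \<notin> K \<and> (\<forall>c. a = Suc c \<longrightarrow> c \<notin> K)"
proof
  assume L: "{a..b} \<in> conn_components K"
  then have sub: "{a..b} \<subseteq> K"
    and max: "\<And>c d. {a..b} \<subseteq> {c..d} \<Longrightarrow> {c..d} \<subseteq> K \<Longrightarrow> {c..d} = {a..b}"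
    unfolding conn_components_def by blast+
  have "Suc b \<notin> K"
  proof
    assume "Suc b \<in> K"
    then have "{a..Suc b} \<subseteq> K" using sub by (auto simp: le_Suc_eq)
    then have "{a..Suc b} = {a..b}" by (intro max) auto
    then show False using assms by auto
  qed
  moreover have "c \<notin> K" if "a = Suc c" for c
  proof
    assume "c \<in> K"
    have "{c..b} = insert c {a..b}" using that assms by auto
    then have "{c..b} \<subseteq> K" using sub \<open>c \<in> K\<close> by auto
    then have "{c..b} = {a..b}" using that by (intro max) auto
    then show False using assms that by auto
  qed
  ultimately show "{a..b} \<subseteq> K \<and> Suc b \<notin> K \<and> (\<forall>c. a = Suc c \<longrightarrow> c \<notin> K)"
    using sub by blast
next
  assume R: "{a..b} \<subseteq> K \<and> Suc b \<notin> K \<and> (\<forall>c. a = Suc c \<longrightarrow> c \<notin> K)"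
  have "{c..d} = {a..b}" if "{a..b} \<subseteq> {c..d}" "{c..d} \<subseteq> K" for c d
  proof -
    have cd: "c \<le> a" "b \<le> d" using that(1) assms by auto
    have "d = b"
    proof (rule ccontr)
      assume "d \<noteq> b"
      then have "Suc b \<in> {c..d}" using cd assms by auto
      then show False using that R by blast
    qed
    moreover have "c = a"
    proof (rule ccontr)
      assume "c \<noteq> a"
      then obtain e where "a = Suc e" "c \<le> e" using cd by (cases a) auto
      then have "e \<in> {c..d}" using cd assms by auto
      then show False using that R \<open>a = Suc e\<close> by blast
    qed
    ultimately show ?thesis by simp
  qed
  then show "{a..b} \<in> conn_components K"
    using R assms unfolding conn_components_def by blast
qed

text \<open>Here \<open>s\<close> counts positions: the \<open>s - 1\<close> elements from
  \<open>p\<close> to \<open>p + s - 2\<close> tie together \<open>s\<close> consecutive positions,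
  and the gap at \<open>p + s - 1\<close> separates this run from all later components.\<close>

lemma conn_components_peel:
  assumes "2 \<le> s" "\<And>i. Suc i < s \<Longrightarrow> p + i \<in> K" "p + s - 1 \<notin> K"
  shows "conn_components (K \<inter> {p..}) = insert {p..p + s - 2} (conn_components (K \<inter> {p + s..}))"
proof (rule set_eqI)
  fix C
  have iv: "i \<in> K" if "p \<le> i" "Suc i < p + s" for i
    using assms(2)[of "i - p"] that by simp
  show "C \<in> conn_components (K \<inter> {p..}) \<longleftrightarrow>
    C \<in> insert {p..p + s - 2} (conn_components (K \<inter> {p + s..}))"
  proof (cases "\<exists>a b. a \<le> b \<and> C = {a..b}")
    case False
    moreover have "p \<le> p + s - 2" using assms(1) by simp
    ultimately have "C \<noteq> {p..p + s - 2}" by blast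
    with False show ?thesis unfolding conn_components_def by blast
  next
    case True
    then obtain a b where ab: "a \<le> b" and C: "C = {a..b}" by blast
    have nmem: "Suc (p + s - 2) \<notin> K" using assms(1,3) by (simp add: Suc_diff_Suc numeral_2_eq_2)
    \<comment> \<open>An interval inside \<open>K\<close> misses the gap, hence lies entirely on one
      side of it.\<close>
    have "p + s - 1 \<notin> {a..b}" if "{a..b} \<subseteq> K" using that assms(3) by blast
    then have cases: "b \<le> p + s - 2 \<or> p + s \<le> a" if "{a..b} \<subseteq> K" using that by fastforce
    show ?thesis
    proof
      assume "C \<in> conn_components (K \<inter> {p..})"
      then have L: "{a..b} \<subseteq> K \<inter> {p..}" "Suc b \<notin> K \<inter> {p..}" "\<And>c. a = Suc c \<Longrightarrow> c \<notin> K \<inter> {p..}"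
        unfolding C interval_in_conn_components[OF ab] by blast+
      have pa: "p \<le> a" using L(1) ab by auto
      from cases L(1) consider "b \<le> p + s - 2" | "p + s \<le> a" by auto
      then show "C \<in> insert {p..p + s - 2} (conn_components (K \<inter> {p + s..}))"
      proof cases
        case 1
        have "a = p"
        proof (rule ccontr)
          assume "a \<noteq> p"
          then have "a = Suc (a - 1)" "p \<le> a - 1" using pa by auto
          moreover have "a - 1 \<in> K" using iv[of "a - 1"] calculation 1 ab assms(1) by auto
          ultimately show False using L(3)[of "a - 1"] by auto
        qed
        moreover have "b = p + s - 2"
        proof (rule ccontr)
          assume "b \<noteq> p + s - 2"
          then have "Suc b \<in> K" using iv[of "Suc b"] 1 ab pa assms(1) by auto
          then show False using L(2) ab pa by auto
        qed
        ultimately show ?thesis using C by simp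
      next
        case 2
        have "{a..b} \<in> conn_components (K \<inter> {p + s..})"
          unfolding interval_in_conn_components[OF ab] using L 2 by auto
        then show ?thesis using C by simp
      qed
    next
      assume R: "C \<in> insert {p..p + s - 2} (conn_components (K \<inter> {p + s..}))"
      show "C \<in> conn_components (K \<inter> {p..})"
      proof (cases "C = {p..p + s - 2}")
        case True
        have "p \<le> p + s - 2" using assms(1) by simp
        then show ?thesis unfolding True
          by (subst interval_in_conn_components) (use nmem assms(1) in \<open>auto intro!: iv\<close>)
      next
        case False
        then have L: "{a..b} \<subseteq> K \<inter> {p + s..}" "Suc b \<notin> K \<inter> {p + s..}"
            "\<And>c. a = Suc c \<Longrightarrow> c \<notin> K \<inter> {p + s..}"
          using R unfolding C using interval_in_conn_components[OF ab] by auto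
        have psa: "p + s \<le> a" using L(1) ab by auto
        have "c \<notin> K" if "a = Suc c" for c
          using L(3)[OF that] psa assms(3) that by (cases "c = p + s - 1") auto
        then show ?thesis
          unfolding C interval_in_conn_components[OF ab] using L psa ab by auto
      qed
    qed
  qed
qed

text \<open>A component with \<open>s - 1\<close> elements contributes
  \<open>((s - 1) + 1) div 2\<close>, half its block size rounded down.\<close>

lemma half_parts_peel:
  assumes "finite K" "2 \<le> s" "\<And>i. Suc i < s \<Longrightarrow> p + i \<in> K" "p + s - 1 \<notin> K"
  shows "half_parts (K \<inter> {p..}) = add_mset (s div 2) (half_parts (K \<inter> {p + s..}))"
proof -
  have "p \<in> {p..p + s - 2}" using assms(2) by simp
  moreover have "p \<notin> C" if "C \<in> conn_components (K \<inter> {p + s..})" for C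
    using that assms(2) unfolding conn_components_def by fastforce
  ultimately have "{p..p + s - 2} \<notin> conn_components (K \<inter> {p + s..})" by blast
  moreover have "finite (conn_components (K \<inter> {p + s..}))"
    using assms(1) by (intro finite_conn_components) simp
  moreover have "(card {p..p + s - 2} + 1) div 2 = s div 2"
    using assms(2) by simp
  ultimately show ?thesis
    using conn_components_peel[OF assms(2-4)] by (simp add: half_parts_def)
qed

lemma half_parts_empty [simp]: "half_parts {} = {#}"
proof -
  have "conn_components {} = {}" by (auto simp: conn_components_def)
  then show ?thesis by (simp add: half_parts_def)
qed

lemma obtain_run:
  assumes "finite K" "p \<in> K"
  obtains s where "2 \<le> s" "\<And>i. Suc i < s \<Longrightarrow> p + i \<in> K" "p + s - 1 \<notin> K"
proof -
  have "\<exists>i. p + i \<notin> K"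
  proof (rule ccontr)
    assume "\<nexists>i. p + i \<notin> K"
    then have "range ((+) p) \<subseteq> K" by auto
    then show False using assms(1) by (metis finite_imageD finite_subset infinite_UNIV_nat inj_on_add)
  qed
  then have "p + (LEAST i. p + i \<notin> K) \<notin> K" by (rule LeastI_ex)
  moreover have "p + i \<in> K" if "i < (LEAST i. p + i \<notin> K)" for i
    using not_less_Least[OF that] by blast
  moreover have "(LEAST i. p + i \<notin> K) \<noteq> 0"
    using calculation(1) assms(2) by (metis add.right_neutral)
  \<comment> \<open>One more than the run length, because \<open>r\<close> comparisons bind
    \<open>r + 1\<close> positions.\<close>
  ultimately show ?thesis
    by (intro that[of "Suc (LEAST i. p + i \<notin> K)"]) auto
qed

section \<open>The twisted algebra\<close>

text \<open>An element of the algebra is the function taking a finite set to the coefficient of the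
  increasing product of its generators, and \<open>cross A B\<close> is the factor for sorting the product of
  the generators in \<open>A\<close> by those in \<open>B\<close>.\<close>

locale odd_weight =
  fixes x :: "'a::field"
  assumes pow_neq_1: "0 < k \<Longrightarrow> x ^ (2 * k) \<noteq> 1"
begin

definition swap :: "nat \<Rightarrow> nat \<Rightarrow> 'a" where
  "swap u v = (if odd u = odd v then - 1 else - x)"

definition cross :: "nat set \<Rightarrow> nat set \<Rightarrow> 'a" where
  "cross A B = (\<Prod>u\<in>A. \<Prod>v\<in>{v\<in>B. v < u}. swap u v)"

text \<open>Summing over complementary pairs only encodes that generators square to zero. For
  infinite \<open>S\<close> the index set is infinite and the sum is 0 by convention.\<close>

definition conv :: "(nat set \<Rightarrow> 'a) \<Rightarrow> (nat set \<Rightarrow> 'a) \<Rightarrow> nat set \<Rightarrow> 'a" (infixl "\<odot>" 70)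
  where "(f \<odot> g) S = (\<Sum>A\<in>Pow S. cross A (S - A) * (f A * g (S - A)))"

text \<open>For a word without repetitions this is the scalar between the product of its generators
  in the given order and their increasing product: one \<open>swap\<close> per inversion.\<close>

primrec weight :: "nat list \<Rightarrow> 'a" where
  "weight [] = 1"
| "weight (u # us) = (\<Prod>v\<in>{v\<in>set us. v < u}. swap u v) * weight us"

lemma cross_Un_left: "finite A \<Longrightarrow> finite B \<Longrightarrow> A \<inter> B = {} \<Longrightarrow>
    cross (A \<union> B) C = cross A C * cross B C"
  unfolding cross_def by (rule prod.union_disjoint)

lemma cross_Un_right:
  assumes "finite B" "finite C" "B \<inter> C = {}"
  shows "cross A (B \<union> C) = cross A B * cross A C"
proof -
  have "(\<Prod>v\<in>{v\<in>B \<union> C. v < u}. swap u v) =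
      (\<Prod>v\<in>{v\<in>B. v < u}. swap u v) * (\<Prod>v\<in>{v\<in>C. v < u}. swap u v)" for u
  proof -
    have "{v\<in>B \<union> C. v < u} = {v\<in>B. v < u} \<union> {v\<in>C. v < u}" by auto
    then show ?thesis
      using assms by (simp add: prod.union_disjoint disjoint_iff)
  qed
  then show ?thesis
    by (simp add: cross_def prod.distrib)
qed

lemma conv_infinite: "infinite S \<Longrightarrow> (f \<odot> g) S = 0"
  by (simp add: conv_def)

text \<open>Since \<open>cross\<close> is multiplicative over disjoint unions in either argument,
  both bracketings expand to the sum over ordered splittings of \<open>S\<close> into three parts,
  weighted by the three pairwise crossings.\<close>

lemma conv_assoc: "f \<odot> g \<odot> h = f \<odot> (g \<odot> h)"
proof
  fix S :: "nat set"
  show "(f \<odot> g \<odot> h) S = (f \<odot> (g \<odot> h)) S"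
  proof (cases "finite S")
    case False
    then show ?thesis by (simp add: conv_infinite)
  next
    case True
    let ?w = "\<lambda>A B. cross A B * cross A (S - A - B) * cross B (S - A - B) * f A * g B * h (S - A - B)"
    have fin: "A \<subseteq> S \<Longrightarrow> finite A" for A
      using True by (rule rev_finite_subset)
    have "(f \<odot> g \<odot> h) S = (\<Sum>C\<in>Pow S. \<Sum>A\<in>Pow C. ?w A (C - A))"
      unfolding conv_def
    proof (rule sum.cong[OF refl])
      fix C assume C: "C \<in> Pow S"
      have "cross C (S - C) * (cross A (C - A) * (f A * g (C - A)) * h (S - C)) = ?w A (C - A)"
        if A: "A \<in> Pow C" for A
      proof -
        have "C = A \<union> (C - A)" using A by blast
        then have "cross C (S - C) = cross A (S - C) * cross (C - A) (S - C)"
          using cross_Un_left[of A "C - A" "S - C"] fin A C by (metis Diff_disjoint Diff_subset Pow_iff order_trans)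
        moreover have "S - A - (C - A) = S - C" using A by auto
        ultimately show ?thesis by (simp add: mult_ac)
      qed
      then show "cross C (S - C) * ((\<Sum>A\<in>Pow C. cross A (C - A) * (f A * g (C - A))) * h (S - C)) =
          (\<Sum>A\<in>Pow C. ?w A (C - A))"
        unfolding sum_distrib_left sum_distrib_right by (intro sum.cong refl)
    qed
    also have "\<dots> = (\<Sum>A\<in>Pow S. \<Sum>B\<in>Pow (S - A). ?w A B)"
    proof -
      have "(\<Sum>C\<in>Pow S. \<Sum>A\<in>Pow C. ?w A (C - A)) =
          (\<Sum>(C, A)\<in>(SIGMA C:Pow S. Pow C). ?w A (C - A))"
        by (rule sum.Sigma) (use True fin in auto)
      also have "\<dots> = (\<Sum>(A, B)\<in>(SIGMA A:Pow S. Pow (S - A)). ?w A B)"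
        \<comment> \<open>The outer set \<open>C\<close> is traded for the middle part
          \<open>B = C - A\<close>.\<close>
        by (rule sum.reindex_bij_witness[of _ "\<lambda>(A, B). (A \<union> B, A)" "\<lambda>(C, A). (A, C - A)"]) auto
      also have "\<dots> = (\<Sum>A\<in>Pow S. \<Sum>B\<in>Pow (S - A). ?w A B)"
        by (rule sum.Sigma[symmetric]) (use True in auto)
      finally show ?thesis .
    qed
    also have "\<dots> = (f \<odot> (g \<odot> h)) S"
      unfolding conv_def
    proof (rule sum.cong[OF refl])
      fix A assume A: "A \<in> Pow S"
      have "cross A (S - A) * (f A * (cross B (S - A - B) * (g B * h (S - A - B)))) = ?w A B"
        if B: "B \<in> Pow (S - A)" for B
      proof -
        have "S - A = B \<union> (S - A - B)" using B by blast
        then have "cross A (S - A) = cross A B * cross A (S - A - B)"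
          using cross_Un_right[of B "S - A - B" A] fin B by (metis Diff_disjoint Diff_subset Pow_iff order_trans)
        then show ?thesis by (simp add: mult_ac)
      qed
      then show "(\<Sum>B\<in>Pow (S - A). ?w A B) =
          cross A (S - A) * (f A * (\<Sum>B\<in>Pow (S - A). cross B (S - A - B) * (g B * h (S - A - B))))"
        unfolding sum_distrib_left by (intro sum.cong refl) (rule sym)
    qed
    finally show ?thesis .
  qed
qed

lemma conv_scale_left: "(\<lambda>S. c * f S) \<odot> g = (\<lambda>S. c * (f \<odot> g) S)"
  by (simp add: fun_eq_iff conv_def sum_distrib_left mult_ac)

lemma conv_scale_right: "f \<odot> (\<lambda>S. c * g S) = (\<lambda>S. c * (f \<odot> g) S)"
  by (simp add: fun_eq_iff conv_def sum_distrib_left mult_ac)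

lemma conv_add_left: "(\<lambda>S. f S + g S) \<odot> h = (\<lambda>S. (f \<odot> h) S + (g \<odot> h) S)"
  by (simp add: fun_eq_iff conv_def sum.distrib algebra_simps)

lemma conv_add_right: "f \<odot> (\<lambda>S. g S + h S) = (\<lambda>S. (f \<odot> g) S + (f \<odot> h) S)"
  by (simp add: fun_eq_iff conv_def sum.distrib algebra_simps)

lemma conv_zero_left: "(\<lambda>S. 0) \<odot> f = (\<lambda>S. 0)"
  by (simp add: fun_eq_iff conv_def)

lemma conv_zero_right: "f \<odot> (\<lambda>S. 0) = (\<lambda>S. 0)"
  by (simp add: fun_eq_iff conv_def)

definition unit :: "nat set \<Rightarrow> 'a" where
  "unit S = (if S = {} then 1 else 0)"

text \<open>Products vanish on infinite sets, so \<open>unit\<close> can be neutral only for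
  functions that do the same.\<close>

lemma conv_unit_left:
  assumes "\<And>S. infinite S \<Longrightarrow> f S = 0"
  shows "unit \<odot> f = f"
proof
  fix S
  show "(unit \<odot> f) S = f S"
  proof (cases "finite S")
    case True
    have "(unit \<odot> f) S = (\<Sum>A\<in>{{}}. cross A (S - A) * (unit A * f (S - A)))"
      unfolding conv_def by (rule sum.mono_neutral_right) (use True in \<open>auto simp: unit_def\<close>)
    then show ?thesis by (simp add: unit_def cross_def)
  qed (simp add: assms conv_infinite)
qed

lemma conv_unit_right:
  assumes "\<And>S. infinite S \<Longrightarrow> f S = 0"
  shows "f \<odot> unit = f"
proof
  fix S
  show "(f \<odot> unit) S = f S"
  proof (cases "finite S")
    case True
    have "(f \<odot> unit) S = (\<Sum>A\<in>{S}. cross A (S - A) * (f A * unit (S - A)))"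
      unfolding conv_def by (rule sum.mono_neutral_right) (use True in \<open>auto simp: unit_def\<close>)
    then show ?thesis by (simp add: unit_def cross_def)
  qed (simp add: assms conv_infinite)
qed

section \<open>Generating functions of words\<close>

text \<open>The sum, over all words satisfying \<open>P\<close>, of the products of their
  generators. Words with a repeated letter give 0 in the algebra, hence the restriction to distinct
  lists.\<close>

definition word_gf :: "(nat list \<Rightarrow> bool) \<Rightarrow> nat set \<Rightarrow> 'a" where
  "word_gf P S = (\<Sum>us | distinct us \<and> set us = S \<and> P us. weight us)"

lemma finite_words: "finite {us. distinct us \<and> set us = S \<and> P us}"
proof (cases "finite S")
  case True
  show ?thesis
    by (rule finite_subset[OF _ finite_lists_length_le[OF True, of "card S"]])
       (auto simp: distinct_card)
next
  case False
  then have "{us. distinct us \<and> set us = S \<and> P us} = {}" by auto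
  then show ?thesis by (simp only: finite.emptyI)
qed

lemma word_gf_Nil: "word_gf (\<lambda>us. us = []) = unit"
proof
  fix S :: "nat set"
  have "{us. distinct us \<and> set us = S \<and> us = []} = (if S = {} then {[]} else {})" by auto
  then show "word_gf (\<lambda>us. us = []) S = unit S"
    unfolding word_gf_def unit_def by (simp only: split: if_split) simp
qed

lemma weight_append:
  "distinct (us @ vs) \<Longrightarrow> weight (us @ vs) = cross (set us) (set vs) * (weight us * weight vs)"
proof (induction us)
  case (Cons u us)
  have "{v \<in> set us \<union> set vs. v < u} = {v \<in> set us. v < u} \<union> {v \<in> set vs. v < u}" by auto
  moreover have "{v \<in> set us. v < u} \<inter> {v \<in> set vs. v < u} = {}" using Cons.prems by auto
  ultimately have "(\<Prod>v\<in>{v \<in> set us \<union> set vs. v < u}. swap u v) =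
      (\<Prod>v\<in>{v \<in> set us. v < u}. swap u v) * (\<Prod>v\<in>{v \<in> set vs. v < u}. swap u v)"
    by (simp add: prod.union_disjoint)
  with Cons show ?case by (simp add: cross_def mult_ac)
qed (simp add: cross_def)

text \<open>The fixed length \<open>s\<close> of the first factor makes the cutting point unique, so
  concatenation is a bijection; \<open>cross\<close> accounts for the inversions between the two
  pieces.\<close>

lemma word_gf_append:
  assumes split: "\<And>us. P us \<longleftrightarrow> (\<exists>vs ws. us = vs @ ws \<and> P1 vs \<and> P2 ws)"
    and len: "\<And>vs. P1 vs \<Longrightarrow> length vs = s"
  shows "word_gf P = word_gf P1 \<odot> word_gf P2"
proof
  fix S :: "nat set"
  show "word_gf P S = (word_gf P1 \<odot> word_gf P2) S"
  proof (cases "finite S")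
    case False
    then have "{us. distinct us \<and> set us = S \<and> P us} = {}" by auto
    then show ?thesis using conv_infinite[OF False, of "word_gf P1" "word_gf P2"]
      by (simp only: word_gf_def[of P] sum.empty)
  next
    case True
    let ?L1 = "\<lambda>A. {us. distinct us \<and> set us = A \<and> P1 us}"
    let ?L2 = "\<lambda>A. {us. distinct us \<and> set us = A \<and> P2 us}"
    let ?T = "SIGMA A:Pow S. ?L1 A \<times> ?L2 (S - A)"
    have "(word_gf P1 \<odot> word_gf P2) S =
        (\<Sum>A\<in>Pow S. \<Sum>(vs, ws)\<in>?L1 A \<times> ?L2 (S - A). cross A (S - A) * (weight vs * weight ws))"
      unfolding conv_def word_gf_def sum_product
      by (intro sum.cong refl) (simp only: sum_distrib_left sum.cartesian_product split_def)
    also have "\<dots> = (\<Sum>(A, vs, ws)\<in>?T. cross A (S - A) * (weight vs * weight ws))"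
      by (subst sum.Sigma) (use True in \<open>auto simp: finite_words split_def\<close>)
    also have "\<dots> = word_gf P S"
      unfolding word_gf_def
    proof (rule sum.reindex_bij_witness[of _ "\<lambda>us. (set (take s us), take s us, drop s us)"
          "\<lambda>(A, vs, ws). vs @ ws"])
      fix t assume t: "t \<in> ?T"
      obtain A vs ws where [simp]: "t = (A, vs, ws)" by (cases t)
      show "(case t of (A, vs, ws) \<Rightarrow> vs @ ws) \<in> {us. distinct us \<and> set us = S \<and> P us}"
        using t split by auto
      show "(set (take s (case t of (A, vs, ws) \<Rightarrow> vs @ ws)),
          take s (case t of (A, vs, ws) \<Rightarrow> vs @ ws), drop s (case t of (A, vs, ws) \<Rightarrow> vs @ ws)) = t"
        using t len by auto
      show "weight (case t of (A, vs, ws) \<Rightarrow> vs @ ws) =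
          (case t of (A, vs, ws) \<Rightarrow> cross A (S - A) * (weight vs * weight ws))"
        using t by (auto simp: weight_append)
    next
      fix us assume us: "us \<in> {us. distinct us \<and> set us = S \<and> P us}"
      then obtain vs ws where *: "us = vs @ ws" "P1 vs" "P2 ws" using split by blast
      then have td: "take s us = vs" "drop s us = ws" using len by auto
      show "(case (set (take s us), take s us, drop s us) of (A, vs, ws) \<Rightarrow> vs @ ws) = us"
        by simp
      have "set ws = S - set vs" "distinct vs" "distinct ws" "set vs \<subseteq> S"
        using us *(1) by auto
      then show "(set (take s us), take s us, drop s us) \<in> ?T"
        unfolding td using *(2,3) by simp
    qed
    finally show ?thesis ..
  qed
qed

section \<open>Monotone blocks as combinations of alternating words\<close>

text \<open>The element h_s with start parity \<open>a\<close>. An increasing product is determined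
  by its set of letters, so all coefficients are 0 or 1.\<close>

definition inc_block :: "nat \<Rightarrow> bool \<Rightarrow> nat set \<Rightarrow> 'a" where
  "inc_block s a S =
     (if finite S \<and> card S = s \<and> alternating a (sorted_list_of_set S) then 1 else 0)"

lemma inc_block_infinite: "infinite S \<Longrightarrow> inc_block s a S = 0"
  by (simp add: inc_block_def)

text \<open>\<open>letter True\<close> is the sum O of the odd generators and
  \<open>letter False\<close> the sum E of the even ones.\<close>

definition letter :: "bool \<Rightarrow> nat set \<Rightarrow> 'a" where
  "letter a S = (if \<exists>v. S = {v} \<and> odd v = a then 1 else 0)"

lemma inc_block_1: "inc_block 1 a = letter a"
proof
  fix S
  show "inc_block 1 a S = letter a S"
  proof (cases "\<exists>v. S = {v}")
    case False
    then have "card S \<noteq> 1" by (auto simp: card_1_singleton_iff)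
    with False show ?thesis by (auto simp: inc_block_def letter_def)
  qed (auto simp: inc_block_def letter_def)
qed

lemma letter_conv:
  assumes "finite S"
  shows "(letter a \<odot> f) S =
    (\<Sum>v | v \<in> S \<and> odd v = a. (\<Prod>u | u \<in> S \<and> u < v. swap v u) * f (S - {v}))"
proof -
  have "(letter a \<odot> f) S =
      (\<Sum>A\<in>(\<lambda>v. {v}) ` {v\<in>S. odd v = a}. cross A (S - A) * (letter a A * f (S - A)))"
    unfolding conv_def
    by (rule sum.mono_neutral_right) (use assms in \<open>auto simp: letter_def\<close>)
  also have "\<dots> = (\<Sum>v | v \<in> S \<and> odd v = a. cross {v} (S - {v}) * f (S - {v}))"
    by (subst sum.reindex) (auto simp: letter_def intro!: sum.cong)
  also have "\<dots> = (\<Sum>v | v \<in> S \<and> odd v = a. (\<Prod>u | u \<in> S \<and> u < v. swap v u) * f (S - {v}))"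
    by (auto simp: cross_def intro!: sum.cong arg_cong2[of _ _ _ _ "(*)"] prod.cong)
  finally show ?thesis .
qed

text \<open>Either the letter is the minimum \<open>u\<close> itself, which crosses nothing, or it
  is a larger element of parity \<open>a\<close>, which crosses \<open>u\<close> at a cost depending
  only on the parity of \<open>u\<close>.\<close>

lemma letter_conv_insert_min:
  assumes "finite S" and u: "\<And>v. v \<in> S \<Longrightarrow> u < v"
  shows "(letter a \<odot> f) (insert u S) =
    (if odd u = a then f S else 0)
    + (if odd u = a then - 1 else - x) * (letter a \<odot> (\<lambda>T. f (insert u T))) S"
proof -
  have nin: "u \<notin> S" using u by blast
  have "(letter a \<odot> f) (insert u S) =
      (\<Sum>v\<in>{v. v = u \<and> odd v = a} \<union> {v \<in> S. odd v = a}.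
         (\<Prod>w | w \<in> insert u S \<and> w < v. swap v w) * f (insert u S - {v}))"
    by (subst letter_conv) (use assms in \<open>auto intro!: sum.cong\<close>)
  also have "\<dots> = (\<Sum>v | v = u \<and> odd v = a.
         (\<Prod>w | w \<in> insert u S \<and> w < v. swap v w) * f (insert u S - {v}))
      + (\<Sum>v | v \<in> S \<and> odd v = a.
         (\<Prod>w | w \<in> insert u S \<and> w < v. swap v w) * f (insert u S - {v}))"
    by (rule sum.union_disjoint) (use assms nin in auto)
  also have "(\<Sum>v | v = u \<and> odd v = a.
         (\<Prod>w | w \<in> insert u S \<and> w < v. swap v w) * f (insert u S - {v})) = (if odd u = a then f S else 0)"
  proof -
    have "{w. w \<in> insert u S \<and> w < u} = {}" using u by (auto dest: less_asym)
    then have "(\<Prod>w | w \<in> insert u S \<and> w < u. swap u w) = 1" by (simp only: prod.empty)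
    moreover have "{v. v = u \<and> odd v = a} = (if odd u = a then {u} else {})" by auto
    ultimately show ?thesis using nin by simp
  qed
  also have "(\<Sum>v | v \<in> S \<and> odd v = a.
         (\<Prod>w | w \<in> insert u S \<and> w < v. swap v w) * f (insert u S - {v})) =
      (if odd u = a then - 1 else - x) * (letter a \<odot> (\<lambda>T. f (insert u T))) S"
    unfolding letter_conv[OF assms(1)] sum_distrib_left
  proof (rule sum.cong[OF refl])
    fix v assume v: "v \<in> {v \<in> S. odd v = a}"
    then have "{w. w \<in> insert u S \<and> w < v} = insert u {w \<in> S. w < v}" using u by auto
    moreover have "insert u S - {v} = insert u (S - {v})" using v nin by auto
    ultimately show "(\<Prod>w | w \<in> insert u S \<and> w < v. swap v w) * f (insert u S - {v}) =
        (if odd u = a then - 1 else - x)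
        * ((\<Prod>w | w \<in> S \<and> w < v. swap v w) * f (insert u (S - {v})))"
      using v nin assms(1) by (auto simp: swap_def)
  qed
  finally show ?thesis .
qed

lemma conv_cong_right: "(\<And>T. T \<subseteq> S \<Longrightarrow> g T = g' T) \<Longrightarrow> (f \<odot> g) S = (f \<odot> g') S"
  by (simp add: conv_def)

text \<open>On finite sets, the sum of \<open>inc_block s a\<close> over all \<open>s\<close>.
  Without the size restriction the recursion on the minimum closes up.\<close>

definition alternating_set :: "bool \<Rightarrow> nat set \<Rightarrow> 'a" where
  "alternating_set a S = (if alternating a (sorted_list_of_set S) then 1 else 0)"

lemma alternating_set_insert_min:
  assumes "finite S" and "\<And>v. v \<in> S \<Longrightarrow> u < v"
  shows "alternating_set a (insert u S) = (if odd u = a then 1 else 0) * alternating_set (\<not> a) S"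
proof -
  have "sorted_list_of_set (insert u S) = u # sorted_list_of_set S"
    using assms by (intro sorted_list_of_set_unique[THEN iffD1])
      (auto simp: card_insert_if)
  then show ?thesis by (simp add: alternating_set_def)
qed

text \<open>Induction on the minimum, simultaneously for both start parities, replaces the pairwise
  cancellation.\<close>

lemma letter_conv_alternating_set:
  assumes "finite S"
  shows "(letter a \<odot> alternating_set a) S =
      (if odd (card S) then x ^ (card S div 2) * alternating_set a S else 0)" (is "?P S")
    and "(letter a \<odot> alternating_set (\<not> a)) S =
      (if S = {} then 0
       else alternating_set a S -
         (if even (card S) then x ^ (card S div 2) * alternating_set (\<not> a) S else 0))" (is "?Q S")
proof -
  have "?P S \<and> ?Q S"
    using assms
  proof (induction S rule: finite_linorder_min_induct)
    case empty
    then show ?case by (simp add: letter_conv)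
  next
    case (insert u S)
    \<comment> \<open>Inserting the minimum uses up the first place of the pattern, which leaves a
      multiple of the function for the opposite start parity.\<close>
    have "(letter a \<odot> (\<lambda>T. alternating_set b (insert u T))) S =
        (letter a \<odot> (\<lambda>T. (if odd u = b then 1 else 0) * alternating_set (\<not> b) T)) S" for b
      using insert.hyps by (intro conv_cong_right alternating_set_insert_min) (auto intro: finite_subset)
    then have step: "(letter a \<odot> alternating_set b) (insert u S) =
        (if odd u = a then alternating_set b S else 0)
        + (if odd u = a then - 1 else - x)
          * ((if odd u = b then 1 else 0) * (letter a \<odot> alternating_set (\<not> b)) S)" for b
      using insert.hyps by (simp add: letter_conv_insert_min conv_scale_right)
    have "u \<notin> S" using insert.hyps by blast
    moreover have "alternating_set b {} = 1" for b by (simp add: alternating_set_def)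
    ultimately show ?case
      using insert.IH insert.hyps
      by (cases "odd u = a") (auto simp: step alternating_set_insert_min elim!: oddE evenE)
  qed
  then show "?P S" "?Q S" by blast+
qed

section \<open>Evaluation of increasing blocks by alternating words\<close>

lemma letter_conv_inc_block:
  "(letter a \<odot> inc_block s b) S =
    (if finite S \<and> card S = Suc s then (letter a \<odot> alternating_set b) S else 0)"
proof (cases "finite S")
  case True
  have "inc_block s b (S - {v}) = (if card S = Suc s then alternating_set b (S - {v}) else 0)"
    if "v \<in> S" for v
  proof -
    have "card S = Suc (card (S - {v}))" using True that by (rule card.remove)
    then show ?thesis using True by (simp add: inc_block_def alternating_set_def)
  qed
  then show ?thesis
    using True by (auto simp: letter_conv intro!: sum.cong sum.neutral)
qed (simp add: conv_infinite)

lemma inc_block_eq: "inc_block s a S = (if finite S \<and> card S = s then alternating_set a S else 0)"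
  by (simp add: inc_block_def alternating_set_def)

text \<open>With the second factor read as a block of size 1, only sets of size 2 matter, and there
  the formula for equal parities gives 0.\<close>

lemma letter_square: "letter a \<odot> letter a = (\<lambda>S. 0)"
  unfolding inc_block_1[symmetric, of a]
  by (subst inc_block_1) (auto simp: fun_eq_iff letter_conv_inc_block letter_conv_alternating_set)

lemma letter_conv_inc_block_even:
  "letter a \<odot> inc_block (2 * k) (\<not> a) = inc_block (2 * k + 1) a"
  by (auto simp: fun_eq_iff letter_conv_inc_block letter_conv_alternating_set inc_block_eq)

text \<open>The correction term mixes the two start parities; this is why even blocks involve two
  words and odd blocks only one.\<close>

lemma letter_conv_inc_block_odd:
  "letter a \<odot> inc_block (2 * k + 1) (\<not> a) =
    (\<lambda>S. inc_block (2 * k + 2) a S - x ^ (k + 1) * inc_block (2 * k + 2) (\<not> a) S)"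
  by (auto simp: fun_eq_iff letter_conv_inc_block letter_conv_alternating_set inc_block_eq)

text \<open>The alternating products of \<open>n\<close> factors O and E:
  \<open>word True (2 * k)\<close> is (OE)^k and \<open>word False (2 * k)\<close> is
  (EO)^k.\<close>

primrec word :: "bool \<Rightarrow> nat \<Rightarrow> nat set \<Rightarrow> 'a" where
  "word a 0 = unit"
| "word a (Suc n) = letter a \<odot> word (\<not> a) n"

lemma word_infinite: "infinite S \<Longrightarrow> word a n S = 0"
  by (cases n) (auto simp: unit_def conv_infinite)

lemma word_conv_word_match: "word a m \<odot> word (a \<noteq> odd m) n = word a (m + n)"
proof (induction m arbitrary: a)
  case 0
  then show ?case by (simp add: conv_unit_left word_infinite)
next
  case (Suc m)
  show ?case using Suc[of "\<not> a"] by (simp add: conv_assoc)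
qed

lemma letter_conv_word: "0 < n \<Longrightarrow> letter a \<odot> word a n = (\<lambda>S. 0)"
  by (cases n) (simp_all add: conv_assoc[symmetric] letter_square conv_zero_left)

text \<open>\<open>a = odd m\<close> is the parity of the last letter of the first word, so two
  equal letters meet and square to zero.\<close>

lemma word_conv_word_clash:
  "0 < m \<Longrightarrow> 0 < n \<Longrightarrow> word a m \<odot> word (a = odd m) n = (\<lambda>S. 0)"
proof (induction m arbitrary: a)
  case (Suc m)
  show ?case
  proof (cases "m = 0")
    case True
    then show ?thesis using Suc.prems
      by (simp add: conv_assoc conv_unit_left word_infinite letter_conv_word)
  next
    case False
    then show ?thesis using Suc.IH[of "\<not> a"] Suc.prems by (simp add: conv_assoc conv_zero_right)
  qed
qed simp

text \<open>The q-Pochhammer symbol (x^2; x^2)_k, the reciprocal of c_k.\<close>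

definition qprod :: "nat \<Rightarrow> 'a" where
  "qprod k = (\<Prod>i = 1..k. 1 - x ^ (2 * i))"

lemma qprod_0 [simp]: "qprod 0 = 1"
  by (simp add: qprod_def)

lemma qprod_Suc: "qprod (Suc k) = qprod k * (1 - x ^ (2 * Suc k))"
  by (simp add: qprod_def)

lemma qprod_nonzero [simp]: "qprod k \<noteq> 0"
  unfolding qprod_def using pow_neq_1 by (auto simp del: power_mult)

text \<open>Induction through the sizes in turn. Prepending a letter to an even block kills the word
  that starts with this letter; passing to the next even block means solving two linear equations.
  At \<open>k = 0\<close> the even formula would count \<open>unit\<close> twice, hence
  \<open>0 < k\<close>.\<close>

lemma
  shows inc_block_odd: "inc_block (2 * k + 1) a = (\<lambda>S. inverse (qprod k) * word a (2 * k + 1) S)"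
    and inc_block_even: "0 < k \<Longrightarrow> inc_block (2 * k) a =
      (\<lambda>S. inverse (qprod k) * (word a (2 * k) S + x ^ k * word (\<not> a) (2 * k) S))"
proof -
  have odd: "inc_block (2 * k + 1) a = (\<lambda>S. inverse (qprod k) * word a (2 * k + 1) S)"
    if "k = 0 \<or> (\<forall>a. inc_block (2 * k) a =
      (\<lambda>S. inverse (qprod k) * (word a (2 * k) S + x ^ k * word (\<not> a) (2 * k) S)))" for k a
  proof (cases "k = 0")
    case True
    then show ?thesis using inc_block_1[of a] inc_block_infinite[of _ 1 a]
      by (simp add: conv_unit_right)
  next
    case False
    have "inc_block (2 * k + 1) a = letter a \<odot> inc_block (2 * k) (\<not> a)"
      by (rule letter_conv_inc_block_even[symmetric])
    also have "\<dots> = (\<lambda>S. inverse (qprod k) * ((letter a \<odot> word (\<not> a) (2 * k)) S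
        + x ^ k * (letter a \<odot> word a (2 * k)) S))"
      using that False by (simp add: conv_scale_right conv_add_right)
    finally show ?thesis using False by (simp add: letter_conv_word)
  qed
  have even_Suc: "inc_block (2 * Suc k) a =
      (\<lambda>S. inverse (qprod (Suc k)) * (word a (2 * Suc k) S + x ^ Suc k * word (\<not> a) (2 * Suc k) S))"
    if "\<forall>a. inc_block (2 * k + 1) a = (\<lambda>S. inverse (qprod k) * word a (2 * k + 1) S)" for k a
  proof
    fix S
    let ?h = "inc_block (2 * k + 2) a S" and ?h' = "inc_block (2 * k + 2) (\<not> a) S"
    have *: "inc_block (2 * k + 2) b S - x ^ (k + 1) * inc_block (2 * k + 2) (\<not> b) S =
        inverse (qprod k) * word b (2 * k + 2) S" for b
      using fun_cong[OF letter_conv_inc_block_odd[of b k], of S] that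
      by (simp add: conv_scale_right)
    \<comment> \<open>Adding \<open>x ^ (k + 1)\<close> times the relation for the opposite parity
      eliminates \<open>?h'\<close>; the determinant of the system is the new factor of
      \<open>qprod\<close>.\<close>
    have "(1 - x ^ (2 * Suc k)) * ?h = (?h - x ^ (k + 1) * ?h') + x ^ (k + 1) * (?h' - x ^ (k + 1) * ?h)"
      by (simp add: algebra_simps flip: power_add mult_2)
    also have "\<dots> = inverse (qprod k) * (word a (2 * k + 2) S + x ^ (k + 1) * word (\<not> a) (2 * k + 2) S)"
      using *[of a] *[of "\<not> a"] by (simp only: not_not) (simp only: algebra_simps)
    finally show "inc_block (2 * Suc k) a S =
      inverse (qprod (Suc k)) * (word a (2 * Suc k) S + x ^ Suc k * word (\<not> a) (2 * Suc k) S)"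
      using pow_neq_1[of "Suc k"] by (simp add: qprod_Suc field_simps)
  qed
  have "(\<forall>a. inc_block (2 * k + 1) a = (\<lambda>S. inverse (qprod k) * word a (2 * k + 1) S)) \<and>
    (0 < k \<longrightarrow> (\<forall>a. inc_block (2 * k) a =
      (\<lambda>S. inverse (qprod k) * (word a (2 * k) S + x ^ k * word (\<not> a) (2 * k) S))))"
  proof (induction k)
    case 0
    then show ?case using odd[of 0] by blast
  next
    case (Suc k)
    then show ?case using odd[of "Suc k"] even_Suc[of k] by blast
  qed
  then show "inc_block (2 * k + 1) a = (\<lambda>S. inverse (qprod k) * word a (2 * k + 1) S)"
    "0 < k \<Longrightarrow> inc_block (2 * k) a =
      (\<lambda>S. inverse (qprod k) * (word a (2 * k) S + x ^ k * word (\<not> a) (2 * k) S))"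
    by blast+
qed

lemma inc_block_interval: "inc_block n a {1..n} = (if n = 0 \<or> a then 1 else 0)"
proof -
  have "sorted_list_of_set {1..n} = [Suc 0..<Suc 0 + n]"
    by (simp add: atLeastLessThanSuc_atLeastAtMost[symmetric] del: upt_Suc)
  then show ?thesis
    using alternating_upt[of a 0 n] by (simp add: inc_block_def)
qed

lemma word_interval_odd: "word True (2 * m + 1) {1..2 * m + 1} = qprod m"
  using inc_block_interval[of "2 * m + 1" True] unfolding inc_block_odd
  by (simp add: divide_simps del: word.simps flip: divide_inverse_commute)

text \<open>The blocks of size \<open>2 * m\<close> have top coefficient 1 for start parity odd and
  0 for even. These are two linear equations for the two word coefficients, and solving them cancels
  the last factor of \<open>qprod m\<close>.\<close>

lemma word_interval_even:
  assumes "0 < m"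
  shows "word True (2 * m) {1..2 * m} = qprod (m - 1)"
    and "word False (2 * m) {1..2 * m} = - (x ^ m) * qprod (m - 1)"
proof -
  let ?T = "word True (2 * m) {1..2 * m}" and ?F = "word False (2 * m) {1..2 * m}"
  have 1: "?T + x ^ m * ?F = qprod m" and 2: "?F + x ^ m * ?T = 0"
    using assms inc_block_interval[of "2 * m" True] inc_block_interval[of "2 * m" False]
    unfolding inc_block_even[OF assms]
    by (simp_all add: divide_simps del: word.simps flip: divide_inverse_commute)
  have F: "?F = - (x ^ m) * ?T"
    using 2 by (simp add: eq_neg_iff_add_eq_0)
  have "x ^ (2 * m) = x ^ m * x ^ m"
    by (simp add: mult_2 power_add)
  then have "(1 - x ^ (2 * m)) * ?T = ?T + x ^ m * ?F"
    unfolding F by (simp add: algebra_simps)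
  also have "\<dots> = qprod (m - 1) * (1 - x ^ (2 * m))"
    using 1 qprod_Suc[of "m - 1"] assms by simp
  finally have "(1 - x ^ (2 * m)) * ?T = qprod (m - 1) * (1 - x ^ (2 * m))" .
  then show T: "?T = qprod (m - 1)"
    using pow_neq_1[OF assms] by simp
  show "?F = - (x ^ m) * qprod (m - 1)"
    using F T by simp
qed

section \<open>Weights of monotone words\<close>

lemma weight_increasing: "sorted_wrt (<) us \<Longrightarrow> weight us = 1"
proof (induction us)
  case (Cons u us)
  then have "{v \<in> set us. v < u} = {}" by (auto dest: less_asym)
  then have "(\<Prod>v\<in>{v \<in> set us. v < u}. swap u v) = 1" by (simp only: prod.empty)
  with Cons show ?case by simp
qed simp

text \<open>Every entry gives a sign, and those of parity opposite to \<open>u\<close> also give an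
  \<open>x\<close>. They are half of the entries, rounded up exactly when the list starts with one
  of them.\<close>

lemma prod_swap_alternating:
  "alternating b us \<Longrightarrow> distinct us \<Longrightarrow> (\<Prod>v\<in>set us. swap u v) =
    (- 1) ^ length us * x ^ ((length us + (if odd u = b then 0 else 1)) div 2)"
proof (induction us arbitrary: b)
  case (Cons v vs)
  then have "(\<Prod>w\<in>set (v # vs). swap u w) = swap u v *
      ((- 1) ^ length vs * x ^ ((length vs + (if odd u = (\<not> b) then 0 else 1)) div 2))"
    using Cons.IH[of "\<not> b"] by simp
  moreover have "odd v = b" using Cons.prems by simp
  ultimately show ?case by (cases "odd u = b") (auto simp: swap_def)
qed simp

text \<open>All s(s-1)/2 pairs are inverted, a number of the same parity as \<open>s div 2\<close>;
  the exponent of \<open>x\<close> counts the pairs of mixed parity.\<close>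

definition dec_weight :: "nat \<Rightarrow> 'a" where
  "dec_weight s = (- 1) ^ (s div 2) * x ^ ((s div 2) * ((s + 1) div 2))"

lemma weight_decreasing:
  "alternating a us \<Longrightarrow> sorted_wrt (>) us \<Longrightarrow> weight us = dec_weight (length us)"
proof (induction us arbitrary: a)
  case Nil
  then show ?case by (simp add: dec_weight_def)
next
  case (Cons u us)
  have dist: "distinct us"
    using Cons.prems sorted_wrt_rev[of "(<)" us] by (simp add: strict_sorted_iff)
  have "{v \<in> set us. v < u} = set us" using Cons.prems by auto
  then have "weight (u # us) = (\<Prod>v\<in>set us. swap u v) * dec_weight (length us)"
    using Cons.IH[of "\<not> a"] Cons.prems by simp
  \<comment> \<open>The entries after \<open>u\<close> alternate from the opposite parity, so the
    exponent is rounded up.\<close>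
  also have "(\<Prod>v\<in>set us. swap u v) = (- 1) ^ length us * x ^ ((length us + 1) div 2)"
    using prod_swap_alternating[of "even u" us u] dist Cons.prems by auto
  also have "\<dots> * dec_weight (length us) = dec_weight (Suc (length us))"
  proof (cases "even (length us)")
    case True
    then obtain k where "length us = 2 * k" by (elim evenE)
    then show ?thesis by (simp add: dec_weight_def power_add mult_ac)
  next
    case False
    then obtain k where "length us = 2 * k + 1" by (elim oddE)
    then show ?thesis by (simp add: dec_weight_def power_add mult_ac)
  qed
  finally show ?case by simp
qed

lemma word_gf_increasing:
  "word_gf (\<lambda>us. length us = s \<and> alternating a us \<and> sorted_wrt (<) us) = inc_block s a"
    (is "word_gf ?P = _")
proof
  fix S :: "nat set"
  let ?l = "sorted_list_of_set S"
  have *: "{us. distinct us \<and> set us = S \<and> ?P us} =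
      (if finite S \<and> card S = s \<and> alternating a ?l then {?l} else {})"
  proof (cases "finite S")
    case True
    have "distinct us \<and> set us = S \<and> ?P us \<longleftrightarrow> us = ?l \<and> card S = s \<and> alternating a us" for us
      using sorted_list_of_set_unique[OF True, of us] True
      by (auto simp: strict_sorted_iff distinct_card)
    then show ?thesis using True by auto
  qed auto
  show "word_gf ?P S = inc_block s a S"
    unfolding word_gf_def * by (simp add: inc_block_def weight_increasing)
qed

text \<open>The only candidate word is the reversed sorted list. Its weight depends on the size
  alone, and reversal changes the start parity exactly for even sizes.\<close>

lemma word_gf_decreasing:
  "word_gf (\<lambda>us. length us = s \<and> alternating a us \<and> sorted_wrt (>) us) =
    (\<lambda>S. dec_weight s * inc_block s (if even s then \<not> a else a) S)"
    (is "word_gf ?P = (\<lambda>S. _ * inc_block s ?a' S)")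
proof
  fix S :: "nat set"
  let ?l = "sorted_list_of_set S"
  have *: "{us. distinct us \<and> set us = S \<and> ?P us} =
      (if finite S \<and> card S = s \<and> alternating ?a' ?l then {rev ?l} else {})"
  proof (cases "finite S")
    case True
    have rev: "sorted_wrt (>) us \<longleftrightarrow> sorted_wrt (<) (rev us)" for us :: "nat list"
      by (simp add: sorted_wrt_rev)
    have dist: "sorted_wrt (>) us \<Longrightarrow> distinct us" for us :: "nat list"
      unfolding rev strict_sorted_iff by simp
    have uniq: "sorted_wrt (>) us \<and> set us = S \<and> length us = card S \<longleftrightarrow> ?l = rev us" for us
      unfolding rev using sorted_list_of_set_unique[OF True, of "rev us"]
      by (simp only: set_rev length_rev)
    have "distinct us \<and> set us = S \<and> ?P us \<longleftrightarrow>
        rev us = ?l \<and> card S = s \<and> alternating a us" for us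
      using dist[of us] uniq[of us] distinct_card[of us] by metis
    moreover have "rev us = ?l \<longleftrightarrow> us = rev ?l" for us by (metis rev_rev_ident)
    moreover have "card S = s \<Longrightarrow> alternating a (rev ?l) = alternating ?a' ?l"
      by (simp add: alternating_rev)
    ultimately show ?thesis using True by auto
  qed auto
  show "word_gf ?P S = dec_weight s * inc_block s ?a' S"
  proof (cases "finite S \<and> card S = s \<and> alternating ?a' ?l")
    case True
    then have "alternating a (rev ?l)" by (auto simp: alternating_rev)
    moreover have "sorted_wrt (>) (rev ?l)" by (simp add: sorted_wrt_rev)
    ultimately have "weight (rev ?l) = dec_weight s" using True by (simp add: weight_decreasing)
    then show ?thesis unfolding word_gf_def * inc_block_def using True by simp
  next
    case False
    then show ?thesis unfolding word_gf_def * inc_block_def by (simp only: if_False) simp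
  qed
qed

section \<open>Multiplying a block onto the words to its right\<close>

text \<open>Of the two words in an even block, the one starting with \<open>c\<close> ends in the
  opposite letter and survives; the other one ends in \<open>c\<close> and is killed.\<close>

lemma inc_block_even_conv_word:
  assumes "0 < k" "0 < n"
  shows "inc_block (2 * k) a \<odot> word c n =
    (\<lambda>S. inverse (qprod k) * ((if c = a then 1 else x ^ k) * word c (n + 2 * k) S))"
proof -
  have "word b (2 * k) \<odot> word c n = (if c = b then word c (n + 2 * k) else (\<lambda>S. 0))" for b
    using word_conv_word_match[of b "2 * k" n] word_conv_word_clash[of "2 * k" n b] assms
    by (cases "c = b") (auto simp: add.commute)
  then show ?thesis
    using assms by (auto simp: inc_block_even conv_scale_left conv_add_left)
qed

lemma inc_block_odd_conv_word:
  assumes "0 < n"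
  shows "inc_block (2 * k + 1) a \<odot> word c n =
    (\<lambda>S. inverse (qprod k) * ((if c = a then 0 else 1) * word a (n + (2 * k + 1)) S))"
proof -
  have "word a (2 * k + 1) \<odot> word c n = (if c = a then (\<lambda>S. 0) else word a (n + (2 * k + 1)))"
    using word_conv_word_match[of a "2 * k + 1" n] word_conv_word_clash[of "2 * k + 1" n a] assms
    by (cases "c = a") (auto simp: add.commute simp del: word.simps)
  then show ?thesis
    unfolding inc_block_odd by (auto simp: conv_scale_left simp del: word.simps)
qed

text \<open>If every block has even size, both alternating words survive; a single block of odd size
  kills one of them.\<close>

definition block_word :: "bool \<Rightarrow> nat \<Rightarrow> nat \<Rightarrow> nat \<Rightarrow> nat set \<Rightarrow> 'a" where
  "block_word a N b d S =
    (if N = 0 then unit S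
     else if 2 * (b + d) = N then x ^ d * word a N S + x ^ b * word (\<not> a) N S
     else x ^ d * word a N S)"

text \<open>An even block multiplies the word starting with parity \<open>\<not> a\<close> by
  \<open>x ^ (s div 2)\<close>, which is absorbed into \<open>x ^ b\<close>. An odd block keeps only
  the term with \<open>x ^ d\<close>. The empty product \<open>N = 0\<close> is separate, being no
  sum of two words.\<close>

lemma inc_block_conv_block_word:
  assumes "2 * (b + d) \<le> N" "0 < s"
  shows "inc_block s a \<odot> block_word (a \<noteq> odd s) N b d =
    (\<lambda>S. inverse (qprod (s div 2)) * block_word a (N + s) (b + s div 2) d S)"
proof (cases "N = 0")
  case True
  then have "block_word (a \<noteq> odd s) N b d = unit"
    by (simp add: block_word_def fun_eq_iff)
  then have L: "inc_block s a \<odot> block_word (a \<noteq> odd s) N b d = inc_block s a"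
    by (simp add: conv_unit_right inc_block_infinite)
  show ?thesis
  proof (cases "even s")
    case even: True
    then obtain k where "s = 2 * k" by (elim evenE)
    then show ?thesis using True assms unfolding L
      by (simp add: block_word_def fun_eq_iff inc_block_even)
  next
    case False
    then obtain k where "s = 2 * k + 1" by (elim oddE)
    then show ?thesis using True assms inc_block_odd[of k a] unfolding L
      by (simp add: block_word_def fun_eq_iff del: word.simps)
  qed
next
  case N: False
  then have N': "0 < N" by simp
  show ?thesis
  proof (cases "even s")
    case even: True
    then obtain k where s: "s = 2 * k" by (elim evenE)
    then have k: "0 < k" using assms by simp
    show ?thesis
    proof (cases "2 * (b + d) = N")
      case True
      then have B: "block_word (a \<noteq> odd s) N b d = (\<lambda>S. x ^ d * word a N S + x ^ b * word (\<not> a) N S)"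
        using N s by (simp add: block_word_def fun_eq_iff)
      then show ?thesis
        using N True k unfolding B unfolding s conv_add_right conv_scale_right
          inc_block_even_conv_word[OF k N']
        by (simp add: block_word_def fun_eq_iff) (simp add: algebra_simps power_add)
    next
      case False
      then have B: "block_word (a \<noteq> odd s) N b d = (\<lambda>S. x ^ d * word a N S)"
        using N s by (simp add: block_word_def fun_eq_iff)
      then show ?thesis
        using N False k unfolding B unfolding s conv_add_right conv_scale_right
          inc_block_even_conv_word[OF k N']
        by (simp add: block_word_def fun_eq_iff)
    qed
  next
    case False
    then obtain k where s: "s = 2 * k + 1" by (elim oddE)
    \<comment> \<open>Halving an odd size loses a position, so the product is in the one-word case
      from here on.\<close>
    have "2 * (b + k + d) \<noteq> N + s" using assms s by simp
    then have R: "block_word a (N + s) (b + s div 2) d = (\<lambda>S. x ^ d * word a (N + s) S)"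
      using s by (simp add: block_word_def fun_eq_iff del: word.simps)
    have c: "(a \<noteq> odd s) = (\<not> a)" using False by simp
    show ?thesis
    proof (cases "2 * (b + d) = N")
      case True
      then have B: "block_word (a \<noteq> odd s) N b d = (\<lambda>S. x ^ d * word (\<not> a) N S + x ^ b * word a N S)"
        using N unfolding c by (simp add: block_word_def fun_eq_iff)
      then show ?thesis
        unfolding B R unfolding s conv_add_right conv_scale_right inc_block_odd_conv_word[OF N']
        by (simp add: fun_eq_iff del: word.simps)
    next
      case False
      then have B: "block_word (a \<noteq> odd s) N b d = (\<lambda>S. x ^ d * word (\<not> a) N S)"
        using N unfolding c by (simp add: block_word_def fun_eq_iff)
      then show ?thesis
        unfolding B R unfolding s conv_add_right conv_scale_right inc_block_odd_conv_word[OF N']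
        by (simp add: fun_eq_iff del: word.simps)
    qed
  qed
qed

text \<open>For even \<open>s\<close>, reversal turns the block into an increasing one of opposite
  start parity, so its extra power of \<open>x\<close> falls on the other word. For odd
  \<open>s\<close> the parity stays, and the surplus \<open>x ^ (s div 2)\<close> of
  \<open>dec_weight\<close> moves into \<open>x ^ d\<close>.\<close>

lemma dec_block_conv_block_word:
  assumes "2 * (b + d) \<le> N" "0 < s"
  shows "(\<lambda>S. dec_weight s * inc_block s (if even s then \<not> a else a) S) \<odot> block_word (a \<noteq> odd s) N b d =
    (\<lambda>S. (- 1) ^ (s div 2) * x ^ (s div 2)\<^sup>2 * inverse (qprod (s div 2))
      * block_word a (N + s) b (d + s div 2) S)"
proof (cases "even s")
  case even: True
  then obtain k where s: "s = 2 * k" by (elim evenE)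
  then have k: "0 < k" using assms by simp
  have "inc_block (2 * k) (\<not> a) \<odot> block_word a N b d =
      (\<lambda>S. inverse (qprod k) * block_word a (N + 2 * k) b (d + k) S)"
  proof (cases "2 * (b + d) = N")
    case True
    \<comment> \<open>With two words present, exchanging the parities amounts to exchanging
      \<open>b\<close> and \<open>d\<close>.\<close>
    have swap: "block_word a N' b' d' = block_word (\<not> a) N' d' b'" if "2 * (b' + d') = N'" for N' b' d'
      using that by (simp add: block_word_def fun_eq_iff add.commute)
    have "block_word a N b d = block_word (\<not> a) N d b"
      using True by (rule swap)
    moreover have "block_word a (N + 2 * k) b (d + k) = block_word (\<not> a) (N + 2 * k) (d + k) b"
      using True by (intro swap) simp
    ultimately show ?thesis
      using inc_block_conv_block_word[of d b N "2 * k" "\<not> a"] assms s by (simp add: add.commute)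
  next
    case False
    then have N: "0 < N" using assms by simp
    have B: "block_word a N b d = (\<lambda>S. x ^ d * word a N S)"
      "block_word a (N + 2 * k) b (d + k) = (\<lambda>S. x ^ (d + k) * word a (N + 2 * k) S)"
      using False N by (simp_all add: block_word_def fun_eq_iff)
    show ?thesis
      unfolding B conv_scale_right inc_block_even_conv_word[OF k N]
      by (simp add: power_add mult_ac)
  qed
  then show ?thesis
    by (simp add: s conv_scale_left dec_weight_def power2_eq_square mult_ac)
next
  case False
  then obtain k where s: "s = 2 * k + 1" by (elim oddE)
  have "2 * (b + k + d) \<noteq> N + s" using assms s by simp
  then have B: "block_word a (N + s) (b + k) d = (\<lambda>S. x ^ d * word a (N + s) S)"
    "block_word a (N + s) b (d + k) = (\<lambda>S. x ^ (d + k) * word a (N + s) S)"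
    using s by (simp_all add: block_word_def fun_eq_iff algebra_simps del: word.simps)
  have k: "s div 2 = k" and dec: "dec_weight s = (- 1) ^ k * x ^ (k\<^sup>2) * x ^ k"
    using s by (simp_all add: dec_weight_def power2_eq_square power_add)
  have a: "(if even s then \<not> a else a) = a" using False by simp
  show ?thesis
    unfolding a conv_scale_left inc_block_conv_block_word[OF assms] k dec B
    by (simp add: power_add mult_ac del: word.simps)
qed

section \<open>Descent classes\<close>

text \<open>The scalars that do not depend on which words survive; the powers \<open>x ^ b\<close>
  and \<open>x ^ d\<close> are kept in \<open>block_word\<close>.\<close>

definition block_coeff :: "nat multiset \<Rightarrow> nat multiset \<Rightarrow> 'a" where
  "block_coeff B D =
     (- 1) ^ sum_mset D * x ^ (\<Sum>k\<in>#D. k\<^sup>2) * inverse (\<Prod>k\<in>#B + D. qprod k)"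

text \<open>Strong induction on the number of remaining positions, peeling off the first block: a
  free position, a run of \<open>I\<close> or a run of \<open>J\<close>. The size bound is carried
  along because the block multiplication lemmas require it.\<close>

lemma word_gf_descent_pattern:
  assumes fin: "finite I" "finite J" and unmixed: "unmixed I J"
    and "\<And>i. i \<in> I \<union> J \<Longrightarrow> Suc i < p + N"
  defines "B \<equiv> \<lambda>p. half_parts (I \<inter> {p..})" and "D \<equiv> \<lambda>p. half_parts (J \<inter> {p..})"
  shows "word_gf (descent_pattern p N a I J) =
      (\<lambda>S. block_coeff (B p) (D p) * block_word a N (sum_mset (B p)) (sum_mset (D p)) S) \<and>
    2 * (sum_mset (B p) + sum_mset (D p)) \<le> N"
  using assms(4)
proof (induction N arbitrary: p a rule: less_induct)
  case (less N)
  have peel: "word_gf (descent_pattern p N a I J) =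
      word_gf (descent_pattern p s a I J) \<odot>
      (\<lambda>S. block_coeff (B (p + s)) (D (p + s)) *
        block_word (a \<noteq> odd s) (N - s) (sum_mset (B (p + s))) (sum_mset (D (p + s))) S)"
    and bound: "2 * (sum_mset (B (p + s)) + sum_mset (D (p + s))) \<le> N - s"
    if "0 < s" "s \<le> N" "p + s - 1 \<notin> I" "p + s - 1 \<notin> J" for s
  proof -
    have IH: "word_gf (descent_pattern (p + s) (N - s) (a \<noteq> odd s) I J) =
      (\<lambda>S. block_coeff (B (p + s)) (D (p + s)) *
        block_word (a \<noteq> odd s) (N - s) (sum_mset (B (p + s))) (sum_mset (D (p + s))) S) \<and>
      2 * (sum_mset (B (p + s)) + sum_mset (D (p + s))) \<le> N - s"
      using that less.prems by (intro less.IH) auto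
    have "word_gf (descent_pattern p N a I J) =
        word_gf (descent_pattern p s a I J) \<odot>
        word_gf (descent_pattern (p + s) (N - s) (a \<noteq> odd s) I J)"
      using descent_pattern_split[OF that]
      by (rule word_gf_append) (simp add: descent_pattern_def)
    with IH show "word_gf (descent_pattern p N a I J) =
      word_gf (descent_pattern p s a I J) \<odot>
      (\<lambda>S. block_coeff (B (p + s)) (D (p + s)) *
        block_word (a \<noteq> odd s) (N - s) (sum_mset (B (p + s))) (sum_mset (D (p + s))) S)"
      "2 * (sum_mset (B (p + s)) + sum_mset (D (p + s))) \<le> N - s"
      by simp_all
  qed
  have disj: "i \<notin> J" "Suc i \<notin> J" if "i \<in> I" for i
    using unmixed that unfolding unmixed_def by blast+
  have disj': "i \<notin> I" "Suc i \<notin> I" if "i \<in> J" for i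
    using unmixed that unfolding unmixed_def by blast+
  have run_in: "i \<in> K" if "\<And>i. Suc i < s \<Longrightarrow> p + i \<in> K" "p \<le> i" "Suc i < p + s" for i s K
    using that(1)[of "i - p"] that(2,3) by simp
  consider "N = 0" | "0 < N" "p \<notin> I" "p \<notin> J" | "p \<in> I" | "p \<in> J" by blast
  then show ?case
  proof cases
    case 1
    have "I \<inter> {p..} = {}" "J \<inter> {p..} = {}" using less.prems 1 by fastforce+
    then have "B p = {#}" "D p = {#}" by (simp_all add: B_def D_def)
    moreover have "descent_pattern p N a I J = (\<lambda>us. us = [])"
      using 1 by (auto simp: descent_pattern_def fun_eq_iff)
    then have "word_gf (descent_pattern p N a I J) = unit"
      by (simp only: word_gf_Nil)
    ultimately show ?thesis
      using 1 by (simp add: block_coeff_def block_word_def fun_eq_iff)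
  next
    case 2
    \<comment> \<open>A free position is an increasing block of size 1 and adds
      \<open>1 div 2 = 0\<close> to the parameters.\<close>
    have gf: "word_gf (descent_pattern p 1 a I J) = inc_block 1 a"
      unfolding word_gf_increasing[symmetric]
      by (rule arg_cong[of _ _ word_gf]) (intro ext descent_pattern_increasing, auto)
    have "I \<inter> {p..} = I \<inter> {p + 1..}" "J \<inter> {p..} = J \<inter> {p + 1..}"
      using 2 by (auto simp: Suc_le_eq order_le_less)
    then have BD: "B p = B (p + 1)" "D p = D (p + 1)" by (simp_all add: B_def D_def)
    have prem: "0 < (1::nat)" "1 \<le> N" "p + 1 - 1 \<notin> I" "p + 1 - 1 \<notin> J" using 2 by auto
    show ?thesis
      using bound[OF prem] prem(2) unfolding peel[OF prem] gf BD conv_scale_right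
        inc_block_conv_block_word[OF bound[OF prem] prem(1)]
      by (simp del: One_nat_def)
  next
    case 3
    obtain s where s: "2 \<le> s" "\<And>i. Suc i < s \<Longrightarrow> p + i \<in> I" "p + s - 1 \<notin> I"
      using obtain_run[OF fin(1) 3] by blast
    have last: "p + s - 2 \<in> I" using s(2)[of "s - 2"] s(1) by simp
    moreover have "Suc (p + s - 2) = p + s - 1" using s(1) by simp
    \<comment> \<open>Unmixedness forbids an element of \<open>J\<close> right after a run of
      \<open>I\<close>, so the block ends at a free boundary.\<close>
    ultimately have nJ: "p + s - 1 \<notin> J" using disj(2) by metis
    have "s \<le> N" using less.prems[of "p + s - 2"] last s(1) by simp
    with s nJ have prem: "0 < s" "s \<le> N" "p + s - 1 \<notin> I" "p + s - 1 \<notin> J" by auto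
    have gf: "word_gf (descent_pattern p s a I J) = inc_block s a"
      unfolding word_gf_increasing[symmetric]
      by (rule arg_cong[of _ _ word_gf]) (intro ext descent_pattern_increasing s(2) disj(1), auto)
    have B: "B p = add_mset (s div 2) (B (p + s))"
      unfolding B_def by (rule half_parts_peel[OF fin(1) s])
    have "i \<notin> J" if "p \<le> i" "i < p + s" for i
    proof (cases "i = p + s - 1")
      case False
      then have "i \<in> I" using that by (intro run_in[OF s(2)]) auto
      then show ?thesis by (rule disj(1))
    qed (use nJ in simp)
    then have "J \<inter> {p..} = J \<inter> {p + s..}" by (auto simp: not_less[symmetric])
    then have D: "D p = D (p + s)" by (simp add: D_def)
    have "2 * (s div 2) \<le> s" by simp
    then have "2 * (sum_mset (B p) + sum_mset (D p)) \<le> N"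
      using bound[OF prem] prem(2) unfolding B D by simp
    moreover have "inverse (qprod (s div 2)) * block_coeff (B (p + s)) (D (p + s)) =
        block_coeff (B p) (D p)"
      by (simp add: block_coeff_def B D)
    ultimately show ?thesis
      using prem(2) unfolding peel[OF prem] gf conv_scale_right
        inc_block_conv_block_word[OF bound[OF prem] prem(1)]
      by (auto simp: fun_eq_iff B D add.commute mult_ac)
  next
    case 4
    obtain s where s: "2 \<le> s" "\<And>i. Suc i < s \<Longrightarrow> p + i \<in> J" "p + s - 1 \<notin> J"
      using obtain_run[OF fin(2) 4] by blast
    have last: "p + s - 2 \<in> J" using s(2)[of "s - 2"] s(1) by simp
    moreover have "Suc (p + s - 2) = p + s - 1" using s(1) by simp
    ultimately have nI: "p + s - 1 \<notin> I" using disj'(2) by metis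
    have "s \<le> N" using less.prems[of "p + s - 2"] last s(1) by simp
    with s nI have prem: "0 < s" "s \<le> N" "p + s - 1 \<notin> I" "p + s - 1 \<notin> J" by auto
    have gf: "word_gf (descent_pattern p s a I J) =
        (\<lambda>S. dec_weight s * inc_block s (if even s then \<not> a else a) S)"
      unfolding word_gf_decreasing[symmetric]
      by (rule arg_cong[of _ _ word_gf]) (intro ext descent_pattern_decreasing s(2) disj'(1), auto)
    have D: "D p = add_mset (s div 2) (D (p + s))"
      unfolding D_def by (rule half_parts_peel[OF fin(2) s])
    have "i \<notin> I" if "p \<le> i" "i < p + s" for i
    proof (cases "i = p + s - 1")
      case False
      then have "i \<in> J" using that by (intro run_in[OF s(2)]) auto
      then show ?thesis by (rule disj'(1))
    qed (use nI in simp)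
    then have "I \<inter> {p..} = I \<inter> {p + s..}" by (auto simp: not_less[symmetric])
    then have B: "B p = B (p + s)" by (simp add: B_def)
    have "2 * (s div 2) \<le> s" by simp
    then have "2 * (sum_mset (B p) + sum_mset (D p)) \<le> N"
      using bound[OF prem] prem(2) unfolding B D by simp
    moreover have "block_coeff (B (p + s)) (D (p + s)) *
        ((- 1) ^ (s div 2) * x ^ (s div 2)\<^sup>2 * inverse (qprod (s div 2))) = block_coeff (B p) (D p)"
      by (simp add: block_coeff_def B D power_add mult_ac)
    ultimately show ?thesis
      using prem(2) unfolding peel[OF prem] gf conv_scale_right
        dec_block_conv_block_word[OF bound[OF prem] prem(1)]
      by (simp add: fun_eq_iff B D add.commute flip: mult.assoc)
  qed
qed

section \<open>Permutations as words\<close>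

text \<open>\<open>weight\<close> recurses from the left, whereas the length functions grow with
  \<open>n\<close> on the right; this adapts the former to the latter.\<close>

lemma weight_snoc:
  assumes "distinct (us @ [v])"
  shows "weight (us @ [v]) = (\<Prod>u\<in>{u \<in> set us. v < u}. swap u v) * weight us"
proof -
  have "(\<Prod>w\<in>{w \<in> {v}. w < u}. swap u w) = (if v < u then swap u v else 1)" for u
    by (subst prod.inter_filter) simp_all
  then have "cross (set us) {v} = (\<Prod>u\<in>{u \<in> set us. v < u}. swap u v)"
    by (simp add: cross_def prod.inter_filter)
  then show ?thesis using weight_append[OF assms] by simp
qed

lemma prod_sign:
  "finite A \<Longrightarrow> (\<Prod>i\<in>A. if P i then - x else - 1) = (- 1) ^ card A * x ^ card {i \<in> A. P i}"
proof (induction A rule: finite_induct)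
  case (insert i A)
  have "{j \<in> insert i A. P j} = (if P i then insert i {j \<in> A. P j} else {j \<in> A. P j})" by auto
  with insert show ?case by simp
qed simp

text \<open>The second hypothesis makes parity comparisons of values and of positions agree, so
  \<open>swap\<close>, which reads values, produces \<open>odd_length\<close>, which reads
  positions.\<close>

lemma weight_map_upt:
  assumes "inj_on \<sigma> {1..n}"
    and "\<And>i j. i \<in> {1..n} \<Longrightarrow> j \<in> {1..n} \<Longrightarrow> odd (\<sigma> i) = odd (\<sigma> j) \<longleftrightarrow> odd i = odd j"
  shows "weight (map \<sigma> [1..<Suc n]) = (- 1) ^ inv_length n \<sigma> * x ^ odd_length n \<sigma>"
  using assms
proof (induction n)
  case 0
  then show ?case by (simp add: inv_length_def odd_length_def)
next
  case (Suc n)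
  have inj: "inj_on \<sigma> {1..n}" using Suc.prems(1) by (rule inj_on_subset) auto
  let ?A = "{i \<in> {1..n}. \<sigma> i > \<sigma> (Suc n)}"
  let ?B = "{i \<in> ?A. i mod 2 \<noteq> Suc n mod 2}"
  let ?R = "\<lambda>n P. {(i, j). i \<in> {1..n} \<and> j \<in> {1..n} \<and> i < j \<and> \<sigma> i > \<sigma> j \<and> P i j}"
  \<comment> \<open>The new inversions are those whose second index is \<open>Suc n\<close>; the
    predicate \<open>P\<close> serves both lengths at once.\<close>
  have split: "card (?R (Suc n) P) = card (?R n P) + card {i \<in> ?A. P i (Suc n)}" for P
  proof -
    have fin: "finite (?R n P)"
      by (rule finite_subset[of _ "{1..n} \<times> {1..n}"]) auto
    have eq: "?R (Suc n) P = ?R n P \<union> (\<lambda>i. (i, Suc n)) ` {i \<in> ?A. P i (Suc n)}"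
      by (auto simp: le_Suc_eq)
    have "card (?R (Suc n) P) =
        card (?R n P) + card ((\<lambda>i. (i, Suc n)) ` {i \<in> ?A. P i (Suc n)})"
      unfolding eq by (rule card_Un_disjoint) (use fin in auto)
    also have "card ((\<lambda>i. (i, Suc n)) ` {i \<in> ?A. P i (Suc n)}) = card {i \<in> ?A. P i (Suc n)}"
      by (rule card_image) (simp add: inj_on_def)
    finally show ?thesis .
  qed
  have lengths: "inv_length (Suc n) \<sigma> = inv_length n \<sigma> + card ?A"
      "odd_length (Suc n) \<sigma> = odd_length n \<sigma> + card ?B"
    using split[of "\<lambda>i j. True"] split[of "\<lambda>i j. i mod 2 \<noteq> j mod 2"]
    by (simp_all add: inv_length_def odd_length_def conj_assoc)
  have dist: "distinct (map \<sigma> [1..<Suc n] @ [\<sigma> (Suc n)])"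
  proof -
    have "distinct (map \<sigma> [1..<Suc (Suc n)])"
      using Suc.prems(1) by (simp add: distinct_map atLeastLessThanSuc_atLeastAtMost del: upt_Suc)
    then show ?thesis by simp
  qed
  have "{u \<in> set (map \<sigma> [1..<Suc n]). \<sigma> (Suc n) < u} = \<sigma> ` ?A"
    by (auto simp: atLeastLessThanSuc_atLeastAtMost simp del: upt_Suc)
  then have "weight (map \<sigma> [1..<Suc (Suc n)]) =
      (\<Prod>u\<in>\<sigma> ` ?A. swap u (\<sigma> (Suc n))) * weight (map \<sigma> [1..<Suc n])"
    using weight_snoc[OF dist] by simp
  also have "(\<Prod>u\<in>\<sigma> ` ?A. swap u (\<sigma> (Suc n))) = (\<Prod>i\<in>?A. swap (\<sigma> i) (\<sigma> (Suc n)))"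
    by (rule prod.reindex_cong[OF _ refl refl]) (rule inj_on_subset[OF inj], auto)
  also have "\<dots> = (\<Prod>i\<in>?A. if i mod 2 \<noteq> Suc n mod 2 then - x else - 1)"
  proof (rule prod.cong[OF refl])
    fix i assume "i \<in> ?A"
    then have "odd (\<sigma> i) = odd (\<sigma> (Suc n)) \<longleftrightarrow> odd i = odd (Suc n)"
      by (intro Suc.prems(2)) auto
    moreover have "i mod 2 \<noteq> Suc n mod 2 \<longleftrightarrow> odd i \<noteq> odd (Suc n)"
      by (auto simp: mod2_eq_if)
    ultimately show "swap (\<sigma> i) (\<sigma> (Suc n)) = (if i mod 2 \<noteq> Suc n mod 2 then - x else - 1)"
      unfolding swap_def by metis
  qed
  also have "\<dots> = (- 1) ^ card ?A * x ^ card ?B"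
    by (rule prod_sign) simp
  also have "weight (map \<sigma> [1..<Suc n]) = (- 1) ^ inv_length n \<sigma> * x ^ odd_length n \<sigma>"
    by (rule Suc.IH[OF inj]) (use Suc.prems(2) in auto)
  finally show ?case
    unfolding lengths by (simp add: power_add mult_ac)
qed

text \<open>One-line notation is the bijection. \<open>a = True\<close> describes
  \<open>chess_plus\<close> and \<open>a = False\<close> describes
  \<open>chess_minus\<close>.\<close>

lemma sum_desc_class:
  assumes "I \<subseteq> {1..n - 1}" "J \<subseteq> {1..n - 1}"
    and X: "X = {w \<in> sym_group n. \<forall>i\<in>{1..n}. odd (w i) = (odd i = a)}"
  shows "(\<Sum>\<sigma>\<in>desc_class n I J X. (- 1) ^ inv_length n \<sigma> * x ^ odd_length n \<sigma>) =
    word_gf (descent_pattern 1 n a I J) {1..n}"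
proof -
  let ?w = "\<lambda>\<sigma>. map \<sigma> [1..<Suc n]"
  let ?L = "{us. distinct us \<and> set us = {1..n} \<and> descent_pattern 1 n a I J us}"
  have nth: "?w \<sigma> ! i = \<sigma> (Suc i)" if "i < n" for \<sigma> :: "nat \<Rightarrow> nat" and i
    using that by (simp del: upt_Suc)
  have pattern: "descent_pattern 1 n a I J (?w \<sigma>) \<longleftrightarrow>
      (\<forall>i\<in>{1..n}. odd (\<sigma> i) = (odd i = a)) \<and> J \<subseteq> descents n \<sigma> \<and> descents n \<sigma> \<subseteq> {1..n - 1} - I"
    if inj: "inj_on \<sigma> {1..n}" for \<sigma>
  proof -
    have "alternating a (?w \<sigma>) \<longleftrightarrow> (\<forall>i<n. odd (\<sigma> (Suc i)) = (a \<noteq> odd i))"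
      unfolding alternating_iff_nth using nth by (simp del: upt_Suc)
    also have "\<dots> \<longleftrightarrow> (\<forall>i\<in>{1..n}. odd (\<sigma> i) = (odd i = a))"
    proof
      assume *: "\<forall>i<n. odd (\<sigma> (Suc i)) = (a \<noteq> odd i)"
      show "\<forall>i\<in>{1..n}. odd (\<sigma> i) = (odd i = a)"
      proof
        fix i assume "i \<in> {1..n}"
        then obtain j where "i = Suc j" "j < n" by (cases i) auto
        then show "odd (\<sigma> i) = (odd i = a)" using * by auto
      qed
    next
      assume *: "\<forall>i\<in>{1..n}. odd (\<sigma> i) = (odd i = a)"
      show "\<forall>i<n. odd (\<sigma> (Suc i)) = (a \<noteq> odd i)"
      proof (intro allI impI)
        fix i assume "i < n"
        then have "odd (\<sigma> (Suc i)) = (odd (Suc i) = a)" using * by auto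
        then show "odd (\<sigma> (Suc i)) = (a \<noteq> odd i)" by auto
      qed
    qed
    finally have alt: "alternating a (?w \<sigma>) \<longleftrightarrow> (\<forall>i\<in>{1..n}. odd (\<sigma> i) = (odd i = a))" .
    have "(\<forall>i. Suc i < n \<longrightarrow> (1 + i \<in> I \<longrightarrow> ?w \<sigma> ! i < ?w \<sigma> ! Suc i) \<and>
          (1 + i \<in> J \<longrightarrow> ?w \<sigma> ! i > ?w \<sigma> ! Suc i)) \<longleftrightarrow>
        (\<forall>i. Suc i < n \<longrightarrow> (Suc i \<in> I \<longrightarrow> \<sigma> (Suc i) < \<sigma> (Suc (Suc i))) \<and>
          (Suc i \<in> J \<longrightarrow> \<sigma> (Suc i) > \<sigma> (Suc (Suc i))))"
      using nth by (simp del: upt_Suc)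
    also have "\<dots> \<longleftrightarrow> (\<forall>i\<in>{1..n - 1}. (i \<in> I \<longrightarrow> \<sigma> i < \<sigma> (Suc i)) \<and> (i \<in> J \<longrightarrow> \<sigma> i > \<sigma> (Suc i)))"
      (is "?l \<longleftrightarrow> ?r")
    proof
      assume ?l
      show ?r
      proof
        fix i assume "i \<in> {1..n - 1}"
        then obtain j where "i = Suc j" "Suc j < n" by (cases i) auto
        then show "(i \<in> I \<longrightarrow> \<sigma> i < \<sigma> (Suc i)) \<and> (i \<in> J \<longrightarrow> \<sigma> i > \<sigma> (Suc i))"
          using \<open>?l\<close> by blast
      qed
    qed auto
    \<comment> \<open>Distinctness of neighbouring values turns a non-descent into a strict
      ascent.\<close>
    also have "\<dots> \<longleftrightarrow> (\<forall>i\<in>{1..n - 1}. (i \<in> I \<longrightarrow> \<not> \<sigma> i > \<sigma> (Suc i)) \<and> (i \<in> J \<longrightarrow> \<sigma> i > \<sigma> (Suc i)))"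
    proof (intro ball_cong refl)
      fix i assume "i \<in> {1..n - 1}"
      then have "i \<in> {1..n}" "Suc i \<in> {1..n}" by (simp_all, linarith+)
      then have "\<sigma> i \<noteq> \<sigma> (Suc i)" using inj_onD[OF inj, of i "Suc i"] by (metis n_not_Suc_n)
      then show "((i \<in> I \<longrightarrow> \<sigma> i < \<sigma> (Suc i)) \<and> (i \<in> J \<longrightarrow> \<sigma> i > \<sigma> (Suc i))) \<longleftrightarrow>
          ((i \<in> I \<longrightarrow> \<not> \<sigma> i > \<sigma> (Suc i)) \<and> (i \<in> J \<longrightarrow> \<sigma> i > \<sigma> (Suc i)))"
        by auto
    qed
    also have "\<dots> \<longleftrightarrow> J \<subseteq> descents n \<sigma> \<and> descents n \<sigma> \<subseteq> {1..n - 1} - I"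
      using assms(1,2) unfolding descents_def by auto
    finally show ?thesis
      unfolding descent_pattern_def alt by (simp del: upt_Suc)
  qed
  show ?thesis
    unfolding word_gf_def
  \<comment> \<open>The inverse shifts list indices, which start at 0, and is the identity outside
    \<open>{1..n}\<close> as \<open>permutes\<close> demands.\<close>
  proof (rule sum.reindex_bij_witness[of _
        "\<lambda>us i. if i \<in> {1..n} then us ! (i - 1) else i" ?w])
    fix \<sigma> assume \<sigma>: "\<sigma> \<in> desc_class n I J X"
    then have perm: "\<sigma> permutes {1..n}" by (simp add: desc_class_def X sym_group_def)
    then have inj: "inj_on \<sigma> {1..n}" by (rule permutes_inj_on)
    have set: "set (?w \<sigma>) = {1..n}"
      using permutes_image[OF perm] by (simp add: atLeastLessThanSuc_atLeastAtMost del: upt_Suc)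
    show "(\<lambda>i. if i \<in> {1..n} then ?w \<sigma> ! (i - 1) else i) = \<sigma>"
      using perm nth by (auto simp: fun_eq_iff permutes_not_in simp del: upt_Suc)
    show "?w \<sigma> \<in> ?L"
      using set inj pattern[OF inj] \<sigma>
      by (simp add: distinct_map desc_class_def X atLeastLessThanSuc_atLeastAtMost del: upt_Suc)
    have "odd (\<sigma> i) = odd (\<sigma> j) \<longleftrightarrow> odd i = odd j" if "i \<in> {1..n}" "j \<in> {1..n}" for i j
      using \<sigma> that unfolding desc_class_def X by blast
    then show "weight (?w \<sigma>) = (- 1) ^ inv_length n \<sigma> * x ^ odd_length n \<sigma>"
      by (rule weight_map_upt[OF inj])
  next
    fix us assume us: "us \<in> ?L"
    let ?\<sigma> = "\<lambda>i. if i \<in> {1..n} then us ! (i - 1) else i"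
    have len: "length us = n" using us by (simp add: descent_pattern_def)
    show w: "?w ?\<sigma> = us"
      by (rule nth_equalityI) (use len nth in \<open>auto simp del: upt_Suc\<close>)
    have "bij_betw ?\<sigma> {1..n} {1..n}"
    proof -
      have "?\<sigma> ` {1..n} = set (?w ?\<sigma>)"
        by (simp only: set_map set_upt atLeastLessThanSuc_atLeastAtMost)
      then have "?\<sigma> ` {1..n} = {1..n}" unfolding w using us by simp
      then show ?thesis by (simp only: bij_betw_def eq_card_imp_inj_on finite_atLeastAtMost)
    qed
    then have perm: "?\<sigma> permutes {1..n}" by (rule bij_imp_permutes) (rule if_not_P)
    then have "descent_pattern 1 n a I J (?w ?\<sigma>)" unfolding w using us by simp
    then show "?\<sigma> \<in> desc_class n I J X"
      unfolding pattern[OF permutes_inj_on[OF perm]] desc_class_def X sym_group_def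
      using perm by blast
  qed
qed

section \<open>q-analogues and specialisation to the indeterminate\<close>

lemma q_int_square: "q_int (x\<^sup>2) k = (1 - x ^ (2 * k)) / (1 - x\<^sup>2)"
  by (simp add: q_int_def power_mult)

text \<open>The powers of \<open>1 - x\<^sup>2\<close> in numerator and denominator cancel because
  the parts sum to \<open>N\<close>.\<close>

lemma q_multinomial_square:
  assumes "sum_mset ns = N"
  shows "q_multinomial (x\<^sup>2) N ns = qprod N / (\<Prod>k\<in>#ns. qprod k)"
proof -
  have nz: "1 - x\<^sup>2 \<noteq> 0" using pow_neq_1[of 1] by simp
  have q: "q_fact (x\<^sup>2) k = qprod k / (1 - x\<^sup>2) ^ k" for k
    by (simp add: q_fact_def qprod_def q_int_square prod_dividef)
  have "(\<Prod>k\<in>#ns. q_fact (x\<^sup>2) k) = (\<Prod>k\<in>#ns. qprod k) / (1 - x\<^sup>2) ^ sum_mset ns" for ns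
    by (induction ns) (simp_all add: q power_add)
  then show ?thesis using nz assms by (simp add: q_multinomial_def q)
qed

lemma qprod_split: "M \<le> m \<Longrightarrow> qprod M * (\<Prod>k = M + 1..m. 1 - x ^ (2 * k)) = qprod m"
  unfolding qprod_def using prod.ub_add_nat[of 1 M "\<lambda>k. 1 - x ^ (2 * k)" "m - M"] by simp

end

lemma odd_weight_indet: "odd_weight indet"
proof
  fix k :: nat
  assume "0 < k"
  have "indet ^ j = to_fract ([:0, 1:] ^ j)" for j
    by (induction j) (simp_all add: indet_def del: mult_pCons_left)
  moreover have "[:0, 1:] ^ (2 * k) \<noteq> (1 :: int poly)"
  proof
    assume "[:0, 1:] ^ (2 * k) = (1 :: int poly)"
    then have "degree ([:0, 1:] ^ (2 * k) :: int poly) = 0" by simp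
    then show False using \<open>0 < k\<close> by (simp add: degree_power_eq)
  qed
  ultimately show "indet ^ (2 * k) \<noteq> 1"
    by (metis to_fract_1 to_fract_eq_iff)
qed

theorem theorem4p2:
  fixes n m b d M \<alpha> :: nat and I J :: "nat set" and x Q :: "int poly fract"
  assumes "n \<ge> 1"
    and "m = n div 2"
    and "I \<subseteq> {1..n - 1}" and "J \<subseteq> {1..n - 1}"
    and "unmixed I J"
    and "b = (\<Sum>k \<in># half_parts I. k)"
    and "d = (\<Sum>k \<in># half_parts J. k)"
    and "M = b + d"
    and "\<alpha> = (\<Sum>k \<in># half_parts J. k ^ 2)"
    and "x = indet"
    and "Q = q_multinomial (x ^ 2) M (half_parts I + half_parts J)"
  shows "(odd n \<longrightarrow>
           signed_odd_gf n (desc_class n I J (chess_plus n)) =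
             (- x) ^ d * x ^ \<alpha> * Q * (\<Prod>k = M + 1..m. 1 - x ^ (2 * k))) \<and>
         (even n \<longrightarrow>
           signed_odd_gf n (desc_class n I J (chess_plus n)) =
             (if m = M
              then (- x) ^ d * x ^ \<alpha> * (q_int (x ^ 2) b / q_int (x ^ 2) m) * Q
              else (- x) ^ d * x ^ \<alpha> * Q * (\<Prod>k = M + 1..m - 1. 1 - x ^ (2 * k))) \<and>
           signed_odd_gf n (desc_class n I J (chess_minus n)) =
             (if m = M
              then (- 1) ^ d * x ^ (b + \<alpha>) * (q_int (x ^ 2) d / q_int (x ^ 2) m) * Q
              else - ((- x) ^ d) * x ^ (m + \<alpha>) * Q * (\<Prod>k = M + 1..m - 1. 1 - x ^ (2 * k))))"
proof -
  interpret odd_weight x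
    using odd_weight_indet by (simp only: assms(10))
  let ?B = "half_parts I" and ?D = "half_parts J"
  define P where "P = (\<Prod>k\<in>#?B + ?D. qprod k)"
  have fin: "finite I" "finite J" using assms(3,4) finite_subset by blast+
  have range: "Suc i < 1 + n" if "i \<in> I \<union> J" for i
  proof -
    have "i \<in> {1..n - 1}" using that assms(3,4) by blast
    then have "1 \<le> i" "i \<le> n - 1" by simp_all
    then show ?thesis by linarith
  qed
  have int: "I \<inter> {1..} = I" "J \<inter> {1..} = J" using assms(3,4) by auto
  have bd: "sum_mset ?B = b" "sum_mset ?D = d" using assms(6,7) by simp_all
  have coeff: "block_coeff ?B ?D = (- 1) ^ d * x ^ \<alpha> * inverse P"
    using assms(9) bd by (simp add: block_coeff_def P_def)
  have gf: "word_gf (descent_pattern 1 n a I J) {1..n} =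
      (- 1) ^ d * x ^ \<alpha> * inverse P * block_word a n b d {1..n}"
    and bound: "2 * M \<le> n" for a
    using word_gf_descent_pattern[OF fin assms(5) range, of a] assms(8)
    by (simp_all only: int bd coeff)
  have "chess_plus n = {w \<in> sym_group n. \<forall>i\<in>{1..n}. odd (w i) = (odd i = True)}"
    unfolding chess_plus_def by (auto simp: mod2_eq_if)
  then have plus: "signed_odd_gf n (desc_class n I J (chess_plus n)) =
      (- 1) ^ d * x ^ \<alpha> * inverse P * block_word True n b d {1..n}"
    unfolding signed_odd_gf_def gf[symmetric] assms(10)[symmetric] by (rule sum_desc_class[OF assms(3,4)])
  have "chess_minus n = {w \<in> sym_group n. \<forall>i\<in>{1..n}. odd (w i) = (odd i = False)}"
    unfolding chess_minus_def by (auto simp: mod2_eq_if)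
  then have minus: "signed_odd_gf n (desc_class n I J (chess_minus n)) =
      (- 1) ^ d * x ^ \<alpha> * inverse P * block_word False n b d {1..n}"
    unfolding signed_odd_gf_def gf[symmetric] assms(10)[symmetric] by (rule sum_desc_class[OF assms(3,4)])
  have Q: "Q = qprod M * inverse P"
    using assms(8,11) bd by (simp add: q_multinomial_square P_def divide_inverse)
  have sign: "(- x) ^ d = (- 1) ^ d * x ^ d"
    by (metis mult_minus1 power_mult_distrib)
  show ?thesis
  proof (intro conjI impI)
    assume "odd n"
    then have n: "n = 2 * m + 1" using assms(2) by simp
    then have "M \<le> m" using bound by simp
    then have "qprod M * (\<Prod>k = M + 1..m. 1 - x ^ (2 * k)) = qprod m"
      by (rule qprod_split)
    \<comment> \<open>Odd \<open>n\<close> rules out the case of two surviving words.\<close>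
    moreover have "2 * (b + d) \<noteq> n" using \<open>odd n\<close> by (metis dvd_triv_left)
    then have "block_word True n b d {1..n} = x ^ d * qprod m"
      using word_interval_odd[of m] assms(1) unfolding n[symmetric] by (simp add: block_word_def)
    ultimately show "signed_odd_gf n (desc_class n I J (chess_plus n)) =
        (- x) ^ d * x ^ \<alpha> * Q * (\<Prod>k = M + 1..m. 1 - x ^ (2 * k))"
      unfolding plus Q sign by (simp add: mult_ac)
  next
    assume "even n"
    then have n: "n = 2 * m" using assms(2) by simp
    then have m: "0 < m" using assms(1) by simp
    note T = word_interval_even[OF m, folded n]
    have le: "M \<le> m" using bound n by simp
    \<comment> \<open>For \<open>m = M\<close> the quotient exchanges the last factor
      \<open>1 - x ^ (2 * m)\<close> of \<open>qprod M\<close> for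
      \<open>1 - x ^ (2 * k)\<close>.\<close>
    have full: "q_int (x\<^sup>2) k / q_int (x\<^sup>2) m * Q = (1 - x ^ (2 * k)) * qprod (m - 1) * inverse P"
      if "m = M" for k
    proof -
      have nz: "1 - x\<^sup>2 \<noteq> 0" "1 - x ^ (2 * m) \<noteq> 0"
        using pow_neq_1[of 1] pow_neq_1[OF m] by auto
      have "qprod M = qprod (m - 1) * (1 - x ^ (2 * m))"
        using qprod_Suc[of "m - 1"] m that by simp
      then show ?thesis
        unfolding Q q_int_square using nz by simp
    qed
    have "n \<noteq> 0" "2 * (b + d) = n \<longleftrightarrow> m = M"
      using m n assms(8) by auto
    then have block_word_eq: "block_word a n b d {1..n} =
        (if m = M then x ^ d * word a n {1..n} + x ^ b * word (\<not> a) n {1..n}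
         else x ^ d * word a n {1..n})" for a
      by (simp add: block_word_def)
    \<comment> \<open>Now \<open>M \<le> m - 1\<close>, so the product completes
      \<open>qprod M\<close> to \<open>qprod (m - 1)\<close>.\<close>
    have rest: "Q * (\<Prod>k = M + 1..m - 1. 1 - x ^ (2 * k)) = qprod (m - 1) * inverse P"
      if "m \<noteq> M"
      using qprod_split[of M "m - 1"] le that unfolding Q by (simp add: mult_ac)
    show "signed_odd_gf n (desc_class n I J (chess_plus n)) =
        (if m = M
         then (- x) ^ d * x ^ \<alpha> * (q_int (x ^ 2) b / q_int (x ^ 2) m) * Q
         else (- x) ^ d * x ^ \<alpha> * Q * (\<Prod>k = M + 1..m - 1. 1 - x ^ (2 * k)))"
    proof (cases "m = M")
      case True
      then have "block_word True n b d {1..n} = x ^ d * qprod (m - 1) + x ^ b * (- (x ^ m) * qprod (m - 1))"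
        using True T block_word_eq[of True] by simp
      \<comment> \<open>Splitting \<open>x ^ m\<close> exposes the common factor
        \<open>x ^ d\<close> of the two words and leaves \<open>1 - x ^ (2 * b)\<close>.\<close>
      also have "x ^ m = x ^ b * x ^ d" using True assms(8) by (simp add: power_add)
      finally have bw: "block_word True n b d {1..n} = x ^ d * ((1 - x ^ (2 * b)) * qprod (m - 1))"
        unfolding mult_2 power_add by (simp add: algebra_simps)
      have "(- x) ^ d * x ^ \<alpha> * (q_int (x\<^sup>2) b / q_int (x\<^sup>2) m) * Q = (- 1) ^ d * x ^ d * x ^ \<alpha> * (q_int (x\<^sup>2) b / q_int (x\<^sup>2) m * Q)"
        unfolding sign by (simp only: mult.assoc)
      also have "\<dots> = (- 1) ^ d * x ^ \<alpha> * inverse P * block_word True n b d {1..n}"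
        unfolding full[OF True] bw by (simp add: mult_ac)
      finally show ?thesis
        using True by (simp only: plus if_True if_False refl)
    next
      case False
      then have bw: "block_word True n b d {1..n} = x ^ d * qprod (m - 1)"
        using False T block_word_eq[of True] by simp
      have "(- x) ^ d * x ^ \<alpha> * Q * (\<Prod>k = M + 1..m - 1. 1 - x ^ (2 * k)) = (- 1) ^ d * x ^ d * x ^ \<alpha> * (Q * (\<Prod>k = M + 1..m - 1. 1 - x ^ (2 * k)))"
        unfolding sign by (simp only: mult.assoc)
      also have "\<dots> = (- 1) ^ d * x ^ \<alpha> * inverse P * block_word True n b d {1..n}"
        unfolding rest[OF False] bw by (simp add: mult_ac)
      finally show ?thesis
        using False by (simp only: plus if_True if_False refl)
    qed
    show "signed_odd_gf n (desc_class n I J (chess_minus n)) =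
        (if m = M
         then (- 1) ^ d * x ^ (b + \<alpha>) * (q_int (x ^ 2) d / q_int (x ^ 2) m) * Q
         else - ((- x) ^ d) * x ^ (m + \<alpha>) * Q * (\<Prod>k = M + 1..m - 1. 1 - x ^ (2 * k)))"
    proof (cases "m = M")
      case True
      then have "block_word False n b d {1..n} = x ^ d * (- (x ^ m) * qprod (m - 1)) + x ^ b * qprod (m - 1)"
        using True T block_word_eq[of False] by simp
      \<comment> \<open>Here the common factor is \<open>x ^ b\<close>, so the roles of
        \<open>b\<close> and \<open>d\<close> are interchanged.\<close>
      also have "x ^ m = x ^ b * x ^ d" using True assms(8) by (simp add: power_add)
      finally have bw: "block_word False n b d {1..n} = x ^ b * ((1 - x ^ (2 * d)) * qprod (m - 1))"
        unfolding mult_2 power_add by (simp add: algebra_simps)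
      have "(- 1) ^ d * x ^ (b + \<alpha>) * (q_int (x\<^sup>2) d / q_int (x\<^sup>2) m) * Q = (- 1) ^ d * (x ^ b * x ^ \<alpha>) * (q_int (x\<^sup>2) d / q_int (x\<^sup>2) m * Q)"
        by (simp only: mult.assoc power_add)
      also have "\<dots> = (- 1) ^ d * x ^ \<alpha> * inverse P * block_word False n b d {1..n}"
        unfolding full[OF True] bw by (simp add: mult_ac)
      finally show ?thesis
        using True by (simp only: minus if_True if_False refl)
    next
      case False
      \<comment> \<open>The surviving word starts with E; its top coefficient supplies the extra
        sign and the power \<open>x ^ m\<close>.\<close>
      then have bw: "block_word False n b d {1..n} = x ^ d * (- (x ^ m) * qprod (m - 1))"
        using False T block_word_eq[of False] by simp
      have "- ((- x) ^ d) * x ^ (m + \<alpha>) * Q * (\<Prod>k = M + 1..m - 1. 1 - x ^ (2 * k)) = - ((- 1) ^ d * x ^ d) * (x ^ m * x ^ \<alpha>) * (Q * (\<Prod>k = M + 1..m - 1. 1 - x ^ (2 * k)))"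
        unfolding sign by (simp only: mult.assoc power_add)
      also have "\<dots> = (- 1) ^ d * x ^ \<alpha> * inverse P * block_word False n b d {1..n}"
        unfolding rest[OF False] bw by (simp add: mult_ac)
      finally show ?thesis
        using False by (simp only: minus if_True if_False refl)
    qed
  qed
qed

end
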